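(* Let $A$ be a separable recursive subhomogeneous C*-algebra with a fixed decomposition $$A=\Big[\cdots\big[[C_0\oplus_{C_1^{(0)}}C_1]\oplus_{C_2^{(0)}}C_2\big]\cdots\Big]\oplus_{C_K^{(0)}}C_K,$$ where $C_i=\mathrm{M}_{n_i}(\mathrm{C}(X_i))$ and $C_i^{(0)}=\mathrm{M}_{n_i}(\mathrm{C}(X_i^{(0)}))$ with $X_i^{(0)}$ a closed subset of the compact Hausdorff space $X_i$, and let $a,b$ be positive elements of $A$. Assume that \begin{enumerate} \item $n_0<n_1<\cdots<n_K$; \item $a$ and $b$ are diagonal matrices on each $X_i$; \item all the maps $\eta_i:A_i\to C_{i+1}^{(0)}$, $i=0,\dots,K-1$, are of diagonal type, where $A_i=[\cdots[[C_0\oplus_{C_1^{(0)}}C_1]\oplus_{C_2^{(0)}}C_2]\cdots]\oplus_{C_i^{(0)}}C_i$; \item for each $i=0,1,\dots,K$ and each $x\in X_i\setminus X_i^{(0)}$, $$\mathrm{rank}(a(x))<\tfrac14\mathrm{rank}(b(x))\qquad\text{and}\qquad\frac1{n_0}<\frac{\mathrm{rank}(b(x))}{4n_i}.$$ \end{enumerate} Then $a\precsim b$ in $A$.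
   Context: Iterated pullback notation: $A_0=C_0$ and, given a unital homomorphism $\eta_i:A_i\to C_{i+1}^{(0)}$, $A_{i+1}=A_i\oplus_{C_{i+1}^{(0)}}C_{i+1}=\{(a,f)\in A_i\oplus C_{i+1}:\eta_i(a)=f|_{X_{i+1}^{(0)}}\}$; the sets $X_i^{(0)}$ may be empty; $A=A_K$. Elements of $A_i$ are written $(f_0,\dots,f_i)$ with $f_j\in C_j$; for $a=(a_0,\dots,a_K)\in A$ and $x\in X_i$, $a(x)=a_i(x)\in\mathrm{M}_{n_i}(\mathbb C)$. A homomorphism $\phi:A_k\to\mathrm{M}_n(\mathrm{C}(Y))$ ($Y$ compact metrizable) is of diagonal type if there is a finite partition $Y=Y_1\sqcup\cdots\sqcup Y_l$ such that for each $Y_i$ there are $s_i\in\mathbb N$, indices $t_1,\dots,t_{s_i}\in\{0,\dots,k\}$ and continuous maps $\lambda_j^{(i)}:Y_i\to X_{t_j}$, $j=1,\dots,s_i$, such that for all $(f_0,\dots,f_k)\in A_k$, $\phi((f_0,\dots,f_k))|_{Y_i}$ equals the block diagonal matrix $\mathrm{diag}(f_{t_1}\circ\lambda_1^{(i)},\dots,f_{t_{s_i}}\circ\lambda_{s_i}^{(i)})$. $a\precsim b$ (Cuntz subequivalence) means there are sequences $x_n,y_n$ in $A$ with $x_nby_n\to a$. *)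

theory Defs
  imports
    "HOL-Analysis.Analysis"
    "Jordan_Normal_Form.Schur_Decomposition"
    "Jordan_Normal_Form.DL_Rank"
begin

record 'e star_alg = "(complex, 'e) module" +
  adj :: "'e \<Rightarrow> 'e"
  nrm :: "'e \<Rightarrow> real"

definition sa_diff :: "'e star_alg \<Rightarrow> 'e \<Rightarrow> 'e \<Rightarrow> 'e" where
  "sa_diff A x y = x \<oplus>\<^bsub>A\<^esub> ((-1) \<odot>\<^bsub>A\<^esub> y)"

definition unital_star_hom :: "'e star_alg \<Rightarrow> 'f star_alg \<Rightarrow> ('e \<Rightarrow> 'f) \<Rightarrow> bool" where
  "unital_star_hom A B \<phi> \<longleftrightarrow>
     \<phi> \<in> Ring.ring_hom A B \<and>
     (\<forall>c. \<forall>x\<in>carrier A. \<phi> (c \<odot>\<^bsub>A\<^esub> x) = c \<odot>\<^bsub>B\<^esub> \<phi> x) \<and>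
     (\<forall>x\<in>carrier A. \<phi> (adj A x) = adj B (\<phi> x))"

definition separable_alg :: "'e star_alg \<Rightarrow> bool" where
  "separable_alg A \<longleftrightarrow>
     (\<exists>D. D \<subseteq> carrier A \<and> countable D \<and>
          (\<forall>x\<in>carrier A. \<forall>\<epsilon>>0. \<exists>d\<in>D. nrm A (sa_diff A x d) < \<epsilon>))"

definition positive_elem :: "'e star_alg \<Rightarrow> 'e \<Rightarrow> bool" where
  "positive_elem A a \<longleftrightarrow> (\<exists>c\<in>carrier A. a = adj A c \<otimes>\<^bsub>A\<^esub> c)"

definition cuntz_below :: "'e star_alg \<Rightarrow> 'e \<Rightarrow> 'e \<Rightarrow> bool" where
  "cuntz_below A a b \<longleftrightarrow>
     (\<exists>x y :: nat \<Rightarrow> 'e.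
        (\<forall>m. x m \<in> carrier A \<and> y m \<in> carrier A) \<and>
        (\<lambda>m. nrm A (sa_diff A (x m \<otimes>\<^bsub>A\<^esub> b \<otimes>\<^bsub>A\<^esub> y m) a)) \<longlonglongrightarrow> 0)"

definition op_norm :: "complex mat \<Rightarrow> real" where
  "op_norm M =
     (let len = (\<lambda>v :: complex vec. L2_set (\<lambda>i. cmod (vec_index v i)) {..<dim_vec v})
      in Sup {len (M *\<^sub>v v) | v. v \<in> carrier_vec (dim_col M) \<and> len v \<le> 1})"

text \<open>
  \<open>M\<^sub>n(C(X))\<close>, realised as matrix-valued functions with continuous entries.  The functions are
  extensional (they take the value \<open>undefined\<close> off the space), so that equality of elements is
  equality of functions on \<open>X\<close>.  The \<open>0\<close> inserted in the norm only matters for empty \<open>X\<close>,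
  where the algebra is the zero algebra.
\<close>

definition matrix_alg :: "'a topology \<Rightarrow> nat \<Rightarrow> ('a \<Rightarrow> complex mat) star_alg" where
  "matrix_alg X n = \<lparr>
     carrier = {f \<in> topspace X \<rightarrow>\<^sub>E carrier_mat n n.
                  \<forall>r<n. \<forall>s<n. continuous_map X euclidean (\<lambda>x. f x $$ (r, s))},
     mult = (\<lambda>f g. \<lambda>x\<in>topspace X. f x * g x),
     one = (\<lambda>x\<in>topspace X. 1\<^sub>m n),
     zero = (\<lambda>x\<in>topspace X. 0\<^sub>m n n),
     add = (\<lambda>f g. \<lambda>x\<in>topspace X. f x + g x),
     smult = (\<lambda>c f. \<lambda>x\<in>topspace X. c \<cdot>\<^sub>m f x),
     adj = (\<lambda>f. \<lambda>x\<in>topspace X. mat_adjoint (f x)),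
     nrm = (\<lambda>f. Sup (insert 0 ((\<lambda>x. op_norm (f x)) ` topspace X))) \<rparr>"

text \<open>
  The data of a decomposition: spaces \<open>X i\<close>, subsets \<open>X0 i\<close>, matrix sizes \<open>n i\<close> and
  attaching maps \<open>\<eta> i\<close> from the \<open>i\<close>-th stage to \<open>M\<^sub>n(C(X0 (Suc i)))\<close> with \<open>n = n (Suc i)\<close>.
  All the spaces carry topologies on (subsets of) one type, which is no restriction, since finitely
  many spaces can be transported into a common type.
  An element \<open>(f\<^sub>0, \<dots>, f\<^sub>i)\<close> of the \<open>i\<close>-th stage is a function \<open>f\<close> on \<open>{..i}\<close>, again
  extensional.
\<close>

primrec rsh_carrier ::
  "(nat \<Rightarrow> 'a topology) \<Rightarrow> (nat \<Rightarrow> 'a set) \<Rightarrow> (nat \<Rightarrow> nat) \<Rightarrow>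
   (nat \<Rightarrow> (nat \<Rightarrow> 'a \<Rightarrow> complex mat) \<Rightarrow> 'a \<Rightarrow> complex mat) \<Rightarrow>
   nat \<Rightarrow> (nat \<Rightarrow> 'a \<Rightarrow> complex mat) set" where
  "rsh_carrier X X0 n \<eta> 0 = (\<Pi>\<^sub>E j\<in>{..0}. carrier (matrix_alg (X j) (n j)))"
| "rsh_carrier X X0 n \<eta> (Suc i) =
     {f \<in> (\<Pi>\<^sub>E j\<in>{..Suc i}. carrier (matrix_alg (X j) (n j))).
        restrict f {..i} \<in> rsh_carrier X X0 n \<eta> i \<and>
        \<eta> i (restrict f {..i}) = restrict (f (Suc i)) (X0 (Suc i))}"

definition rsh_alg ::
  "(nat \<Rightarrow> 'a topology) \<Rightarrow> (nat \<Rightarrow> 'a set) \<Rightarrow> (nat \<Rightarrow> nat) \<Rightarrow>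
   (nat \<Rightarrow> (nat \<Rightarrow> 'a \<Rightarrow> complex mat) \<Rightarrow> 'a \<Rightarrow> complex mat) \<Rightarrow>
   nat \<Rightarrow> (nat \<Rightarrow> 'a \<Rightarrow> complex mat) star_alg" where
  "rsh_alg X X0 n \<eta> i =
     (let C = (\<lambda>j. matrix_alg (X j) (n j)) in \<lparr>
     carrier = rsh_carrier X X0 n \<eta> i,
     mult = (\<lambda>f g. \<lambda>j\<in>{..i}. f j \<otimes>\<^bsub>C j\<^esub> g j),
     one = (\<lambda>j\<in>{..i}. \<one>\<^bsub>C j\<^esub>),
     zero = (\<lambda>j\<in>{..i}. \<zero>\<^bsub>C j\<^esub>),
     add = (\<lambda>f g. \<lambda>j\<in>{..i}. f j \<oplus>\<^bsub>C j\<^esub> g j),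
     smult = (\<lambda>c f. \<lambda>j\<in>{..i}. c \<odot>\<^bsub>C j\<^esub> f j),
     adj = (\<lambda>f. \<lambda>j\<in>{..i}. adj (C j) (f j)),
     nrm = (\<lambda>f. Max ((\<lambda>j. nrm (C j) (f j)) ` {..i})) \<rparr>)"

text \<open>
  The convention \<open>X0 0 = {}\<close> accounts for the bottom stage, to which nothing is attached.
\<close>

definition rsh_decomposition ::
  "nat \<Rightarrow> (nat \<Rightarrow> 'a topology) \<Rightarrow> (nat \<Rightarrow> 'a set) \<Rightarrow> (nat \<Rightarrow> nat) \<Rightarrow>
   (nat \<Rightarrow> (nat \<Rightarrow> 'a \<Rightarrow> complex mat) \<Rightarrow> 'a \<Rightarrow> complex mat) \<Rightarrow> bool" where
  "rsh_decomposition K X X0 n \<eta> \<longleftrightarrow>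
     (\<forall>i\<le>K. compact_space (X i) \<and> Hausdorff_space (X i) \<and> closedin (X i) (X0 i) \<and> 0 < n i) \<and>
     X0 0 = {} \<and>
     (\<forall>i<K. unital_star_hom (rsh_alg X X0 n \<eta> i)
        (matrix_alg (subtopology (X (Suc i)) (X0 (Suc i))) (n (Suc i))) (\<eta> i))"

text \<open>
  A homomorphism \<open>\<phi>\<close> from \<open>A\<close>, the \<open>k\<close>-th stage over the spaces \<open>X\<close>, to a matrix algebra
  over \<open>C(Y)\<close>, with \<open>Y\<close> compact metrizable.  The parts of the partition need not be open or
  closed.
\<close>

definition diagonal_type ::
  "(nat \<Rightarrow> 'a topology) \<Rightarrow> nat \<Rightarrow> (nat \<Rightarrow> 'a \<Rightarrow> complex mat) star_alg \<Rightarrow> 'b topology \<Rightarrow>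
   ((nat \<Rightarrow> 'a \<Rightarrow> complex mat) \<Rightarrow> 'b \<Rightarrow> complex mat) \<Rightarrow> bool" where
  "diagonal_type X k A Y \<phi> \<longleftrightarrow>
     compact_space Y \<and> metrizable_space Y \<and>
     (\<exists>\<P>. finite \<P> \<and> partition_on (topspace Y) \<P> \<and>
       (\<forall>P\<in>\<P>. \<exists>(s::nat) (t :: nat \<Rightarrow> nat) (l :: nat \<Rightarrow> 'b \<Rightarrow> 'a).
          (\<forall>j<s. t j \<le> k \<and> continuous_map (subtopology Y P) (X (t j)) (l j)) \<and>
          (\<forall>f\<in>carrier A. \<forall>y\<in>P.
             \<phi> f y = diag_block_mat (map (\<lambda>j. f (t j) (l j y)) [0..<s]))))"

end

theory Submission
  imports Defs
begin

text \<open>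
  Write \<open>E(x)\<close> for the indices \<open>r\<close> with \<open>a(x)\<^sub>r\<^sub>r \<ge> \<epsilon>\<close> and \<open>F(x)\<close> for those with
  \<open>b(x)\<^sub>r\<^sub>r \<noteq> 0\<close>.  If \<open>V \<in> A\<close> is selfadjoint and at every point its submatrix with rows \<open>F(x)\<close> and
  columns \<open>E(x)\<close> is injective, then with \<open>h = min(1, a/\<epsilon>)\<close> the element
  \<open>T = h V b V h + (1 - h)\<close> is invertible in \<open>A\<close>, and \<open>k = (a - \<epsilon>)\<^sub>+\<^bsup>1/2\<^esup>\<close> satisfies
  \<open>(k T\<^bsup>-1\<^esup> h V) b (V k) = k\<^sup>2 = (a - \<epsilon>)\<^sub>+\<close>.

  Such a \<open>V\<close> is found among matrices with entries \<open>t/(1 + t\<^sup>2)\<close>, where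
  \<open>t = w\<^sub>p w\<^bsub>p+1\<^esub> \<cdots> w\<^bsub>q-1\<^esub>\<close> for a chain of weights \<open>0 \<le> w\<^sub>k < 1\<close>.  A vanishing weight splits
  the matrix into diagonal blocks, so the family is closed under block sums; and if no weight
  vanishes the matrix is a rescaled Cauchy matrix, all of whose minors are nonzero.  Hence \<open>V\<close> is
  good at \<open>x\<close> as soon as every block contains at most as many indices of \<open>E(x)\<close> as of \<open>F(x)\<close>.
  Since the weights range over a convex set, they extend from \<open>X\<^sub>i\<^bsup>(0)\<^esup>\<close> to \<open>X\<^sub>i\<close> by Tietze's theorem,
  with no restriction on the dimension.
\<close>

section \<open>Cauchy matrices and chains of weights\<close>

text \<open>Clearing denominators yields a polynomial of degree below \<open>card I\<close> with
  \<open>card J\<close> distinct roots \<open>Y q\<close>, hence the zero polynomial. The two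
  families of nodes may overlap; positivity keeps every denominator nonzero.\<close>

lemma cauchy_combination_zero:
  fixes X :: "'i \<Rightarrow> real" and Y :: "'j \<Rightarrow> real" and d :: "'i \<Rightarrow> complex"
  assumes I: "finite I" "inj_on X I" "\<And>p. p \<in> I \<Longrightarrow> X p > 0"
    and J: "finite J" "inj_on Y J" "\<And>q. q \<in> J \<Longrightarrow> Y q > 0"
    and card: "card I \<le> card J"
    and zero: "\<And>q. q \<in> J \<Longrightarrow> (\<Sum>p\<in>I. d p / of_real (X p + Y q)) = 0"
    and p: "p \<in> I"
  shows "d p = 0"
proof -
  \<comment> \<open>The numerator of the sum of \<open>d p / (X p + z)\<close> over the common
    denominator, as a polynomial in \<open>z\<close>.\<close>
  define P where
    "P = (\<Sum>p\<in>I. Polynomial.smult (d p) (\<Prod>k\<in>I - {p}. [:complex_of_real (X k), 1:]))"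
  have eval: "poly P z = (\<Sum>p\<in>I. d p * (\<Prod>k\<in>I - {p}. of_real (X k) + z))" for z
    by (simp add: P_def poly_sum poly_prod add.commute)
  have root: "poly P (of_real (Y q)) = 0" if q: "q \<in> J" for q
  proof -
    have nz: "of_real (X k + Y q) \<noteq> (0::complex)" if "k \<in> I" for k
      using I(3)[OF that] J(3)[OF q] by (metis add_pos_pos of_real_eq_0_iff less_irrefl)
    have "poly P (of_real (Y q))
        = (\<Sum>p\<in>I. d p / of_real (X p + Y q) * (\<Prod>k\<in>I. of_real (X k + Y q)))"
      unfolding eval
    proof (rule sum.cong[OF refl])
      fix r assume r: "r \<in> I"
      have "(\<Prod>k\<in>I. complex_of_real (X k + Y q))
          = of_real (X r + Y q) * (\<Prod>k\<in>I - {r}. of_real (X k + Y q))"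
        by (rule prod.remove[OF I(1) r])
      then show "d r * (\<Prod>k\<in>I - {r}. of_real (X k) + of_real (Y q))
          = d r / of_real (X r + Y q) * (\<Prod>k\<in>I. of_real (X k + Y q))"
        using nz[OF r] by simp
    qed
    also have "\<dots> = (\<Sum>p\<in>I. d p / of_real (X p + Y q)) * (\<Prod>k\<in>I. of_real (X k + Y q))"
      by (simp add: sum_distrib_right)
    finally show ?thesis by (simp only: zero[OF q] mult_zero_left)
  qed
  have deg: "degree P \<le> card I - 1"
    unfolding P_def
  proof (rule degree_sum_le[OF I(1)])
    fix r assume r: "r \<in> I"
    have "degree (Polynomial.smult (d r) (\<Prod>k\<in>I - {r}. [:complex_of_real (X k), 1:]))
        \<le> degree (\<Prod>k\<in>I - {r}. [:complex_of_real (X k), 1:])"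
      by (rule degree_smult_le)
    also have "\<dots> \<le> (\<Sum>k\<in>I - {r}. degree [:complex_of_real (X k), 1:])"
      using degree_prod_sum_le[of "I - {r}" "\<lambda>k. [:complex_of_real (X k), 1:]"] I(1)
      by (simp add: o_def)
    also have "\<dots> = card I - 1" using I(1) r by simp
    finally show "degree (Polynomial.smult (d r) (\<Prod>k\<in>I - {r}. [:complex_of_real (X k), 1:])) \<le> card I - 1" .
  qed
  have "P = 0"
  proof (rule ccontr)
    assume nz: "P \<noteq> 0"
    have inj: "inj_on (\<lambda>q. complex_of_real (Y q)) J"
      using J(2) by (simp add: inj_on_def)
    have "card J = card ((\<lambda>q. complex_of_real (Y q)) ` J)"
      using inj by (simp add: card_image)
    also have "\<dots> \<le> card {z. poly P z = 0}"
      using root by (intro card_mono poly_roots_finite[OF nz]) auto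
    also have "\<dots> \<le> degree P" by (rule card_poly_roots_bound[OF nz])
    also have "\<dots> < card I" using deg p I(1) card_gt_0_iff[of I] by fastforce
    finally show False using card by simp
  qed
  \<comment> \<open>At \<open>- X p\<close> every summand with \<open>r \<noteq> p\<close> has a
    zero factor. What is left is \<open>d p\<close> times a product of differences of distinct
    nodes.\<close>
  then have "0 = poly P (- of_real (X p))" by simp
  also have "\<dots> = (\<Sum>r\<in>I. if r = p then d p * (\<Prod>k\<in>I - {p}. of_real (X k) - of_real (X p)) else 0)"
    unfolding eval
  proof (rule sum.cong[OF refl])
    fix r assume r: "r \<in> I"
    have "(\<Prod>k\<in>I - {r}. complex_of_real (X k) + - of_real (X p)) = 0" if "r \<noteq> p"
      using that p I(1) by (intro prod_zero) auto
    then show "d r * (\<Prod>k\<in>I - {r}. of_real (X k) + - of_real (X p))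
        = (if r = p then d p * (\<Prod>k\<in>I - {p}. of_real (X k) - of_real (X p)) else 0)"
      by auto
  qed
  also have "\<dots> = d p * (\<Prod>k\<in>I - {p}. of_real (X k) - of_real (X p))"
    using p I(1) by simp
  finally have *: "d p * (\<Prod>k\<in>I - {p}. complex_of_real (X k) - of_real (X p)) = 0" by simp
  have "(\<Prod>k\<in>I - {p}. complex_of_real (X k) - of_real (X p)) \<noteq> 0"
    using I(1,2) p by (auto simp: inj_on_def)
  then show ?thesis using * by simp
qed

text \<open>A zero weight \<open>w k\<close> cuts the indices between \<open>k\<close> and
  \<open>k + 1\<close>. Nonvanishing of the ratio is thus an equivalence relation, and its classes,
  the blocks, are intervals.\<close>

definition chain_ratio :: "(nat \<Rightarrow> real) \<Rightarrow> nat \<Rightarrow> nat \<Rightarrow> real" where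
  "chain_ratio w p q = prod w {min p q..<max p q}"

lemma chain_ratio_sym: "chain_ratio w p q = chain_ratio w q p"
  by (simp add: chain_ratio_def min.commute max.commute)

lemma chain_ratio_refl [simp]: "chain_ratio w p p = 1"
  by (simp add: chain_ratio_def)

lemma chain_ratio_nonzero_iff:
  "chain_ratio w p q \<noteq> 0 \<longleftrightarrow> (\<forall>k. min p q \<le> k \<and> k < max p q \<longrightarrow> w k \<noteq> 0)"
  by (auto simp: chain_ratio_def)

lemma chain_ratio_nonzero_trans:
  assumes "chain_ratio w p q \<noteq> 0" "chain_ratio w q r \<noteq> 0"
  shows "chain_ratio w p r \<noteq> 0"
  unfolding chain_ratio_nonzero_iff
proof (intro allI impI)
  fix k assume k: "min p r \<le> k \<and> k < max p r"
  then have "(min p q \<le> k \<and> k < max p q) \<or> (min q r \<le> k \<and> k < max q r)" by linarith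
  then show "w k \<noteq> 0" using assms unfolding chain_ratio_nonzero_iff by blast
qed

text \<open>Within a block the chain ratio is a quotient of nodes, so \<open>t / (1 + t\<^sup>2)\<close> turns it into
  a Cauchy kernel in the squared nodes.\<close>

definition chain_node :: "(nat \<Rightarrow> real) \<Rightarrow> nat \<Rightarrow> real" where
  "chain_node w p = (\<Prod>k<p. if w k = 0 then 1 else w k)"

lemma chain_node_pos: "(\<And>k. 0 \<le> w k) \<Longrightarrow> 0 < chain_node w p"
  unfolding chain_node_def by (rule prod_pos) (simp add: order_less_le)

text \<open>Nodes count a zero weight as 1 so that they stay positive across cuts. Between two
  indices of one block no weight vanishes, so there the replacement changes nothing.\<close>

lemma chain_node_split:
  assumes "p \<le> q" "chain_ratio w p q \<noteq> 0"
  shows "chain_node w q = chain_node w p * chain_ratio w p q"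
proof -
  have "chain_node w q = chain_node w p * (\<Prod>k\<in>{p..<q}. if w k = 0 then 1 else w k)"
    unfolding chain_node_def using assms(1)
    by (simp add: lessThan_atLeast0 prod.atLeastLessThan_concat)
  also have "(\<Prod>k\<in>{p..<q}. if w k = 0 then 1 else w k) = prod w {p..<q}"
    using assms by (intro prod.cong) (auto simp: chain_ratio_nonzero_iff)
  finally show ?thesis using assms(1) by (simp add: chain_ratio_def min_def max_def)
qed

text \<open>Weights below 1 make the nodes strictly decreasing inside a block. Nodes of different
  blocks may coincide, which is why the ratio must be nonzero.\<close>

lemma chain_node_inj:
  assumes w: "\<And>k. 0 \<le> w k" "\<And>k. w k < 1"
    and "chain_ratio w p q \<noteq> 0" "chain_node w p = chain_node w q"
  shows "p = q"
proof -
  have False if pq: "p < q" "chain_ratio w p q \<noteq> 0" "chain_node w p = chain_node w q" for p q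
  proof -
    have "chain_ratio w p q = prod w {p..<q}"
      using pq(1) by (simp add: chain_ratio_def)
    also have "\<dots> = w p * prod w {Suc p..<q}" using pq(1) by (simp add: prod.atLeast_Suc_lessThan)
    also have "\<dots> \<le> w p * 1"
      by (intro mult_left_mono prod_le_1) (auto simp: w less_imp_le)
    also have "\<dots> < 1" by (simp add: w)
    finally show False
      using chain_node_split[of p q w] pq chain_node_pos[of w p] w by auto
  qed
  then show ?thesis using assms(3,4) chain_ratio_sym by (metis linorder_neqE_nat)
qed

text \<open>The function \<open>t / (1 + t^2)\<close> is invariant under
  \<open>t \<mapsto> 1 / t\<close>, so it does not matter which node is the larger one. The product
  of nodes in the numerator only rescales rows and columns of the Cauchy matrix.\<close>

lemma cauchy_kernel_chain_ratio:
  assumes "\<And>k. 0 \<le> w k" "chain_ratio w p q \<noteq> 0"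
  shows "chain_ratio w p q / (1 + (chain_ratio w p q)\<^sup>2)
       = chain_node w p * chain_node w q / ((chain_node w p)\<^sup>2 + (chain_node w q)\<^sup>2)"
proof -
  have *: "t / (1 + t\<^sup>2) = x * y / (x\<^sup>2 + y\<^sup>2)" if "x > 0" "y = x * t" for x y t :: real
  proof -
    have "x * y / (x\<^sup>2 + y\<^sup>2) = x\<^sup>2 * t / (x\<^sup>2 * (1 + t\<^sup>2))"
      using that by (simp add: power2_eq_square algebra_simps)
    then show ?thesis using that(1) by simp
  qed
  show ?thesis
  proof (cases "p \<le> q")
    case True
    then show ?thesis using * chain_node_pos[of w p] chain_node_split[OF True assms(2)] assms(1) by blast
  next
    case False
    then have "q \<le> p" "chain_ratio w q p \<noteq> 0" using assms(2) chain_ratio_sym[of w p q] by auto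
    from *[OF _ chain_node_split[OF this]] show ?thesis
      using chain_node_pos[of w q] assms(1)
      by (simp add: chain_ratio_sym[of w p q] mult.commute add.commute)
  qed
qed

text \<open>The kernel vanishes between different blocks, so the equations at the rows in the block
  of \<open>p\<close> involve only the columns in that block. There the matrix is a rescaled Cauchy
  matrix with at least as many rows as columns.\<close>

lemma chain_kernel_injective:
  fixes c :: "nat \<Rightarrow> complex"
  assumes w: "\<And>k. 0 \<le> w k" "\<And>k. w k < 1"
    and fin: "finite E" "finite F"
    and card: "\<And>p. p \<in> E \<Longrightarrow> card {r\<in>E. chain_ratio w r p \<noteq> 0} \<le> card {q\<in>F. chain_ratio w q p \<noteq> 0}"
    and zero: "\<And>q. q \<in> F \<Longrightarrow>
      (\<Sum>p\<in>E. of_real (chain_ratio w q p / (1 + (chain_ratio w q p)\<^sup>2)) * c p) = 0"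
    and p: "p \<in> E"
  shows "c p = 0"
proof -
  define I where "I = {r\<in>E. chain_ratio w r p \<noteq> 0}"
  define J where "J = {q\<in>F. chain_ratio w q p \<noteq> 0}"
  \<comment> \<open>Squared nodes are the Cauchy nodes for rows and columns alike; \<open>d\<close>
    absorbs the column scaling into the coefficients.\<close>
  define Z where "Z k = (chain_node w k)\<^sup>2" for k
  define d where "d k = of_real (chain_node w k) * c k" for k
  have pos: "Z k > 0" for k using chain_node_pos[of w k] w by (simp add: Z_def)
  have rel: "chain_ratio w r s \<noteq> 0" if "r \<in> I \<union> J" "s \<in> I \<union> J" for r s
    using that chain_ratio_nonzero_trans[of w r p s] chain_ratio_sym[of w s p]
    unfolding I_def J_def by auto
  have inj: "inj_on Z (I \<union> J)"
  proof (rule inj_onI)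
    fix r s assume rs: "r \<in> I \<union> J" "s \<in> I \<union> J" "Z r = Z s"
    have "chain_node w r > 0" "chain_node w s > 0" by (simp_all add: chain_node_pos w)
    then have "chain_node w r = chain_node w s"
      using rs(3) by (simp add: Z_def power2_eq_iff_nonneg)
    then show "r = s" using chain_node_inj[OF w rel] rs by blast
  qed
  have "d p = 0"
  proof (rule cauchy_combination_zero[where I = I and J = J and X = Z and Y = Z])
    show "finite I" "finite J" using fin by (auto simp: I_def J_def)
    show "inj_on Z I" "inj_on Z J" using inj by (auto intro: inj_on_subset)
    show "card I \<le> card J" using card[OF p] by (simp add: I_def J_def)
    show "p \<in> I" using p by (simp add: I_def)
    fix q assume q: "q \<in> J"
    have "0 = (\<Sum>r\<in>E. of_real (chain_ratio w q r / (1 + (chain_ratio w q r)\<^sup>2)) * c r)"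
      using zero[of q] q by (simp add: J_def)
    \<comment> \<open>A column with nonzero entry in row \<open>q\<close> lies in the block of
      \<open>q\<close>, which is the block of \<open>p\<close>.\<close>
    also have "\<dots> = (\<Sum>r\<in>I. of_real (chain_ratio w q r / (1 + (chain_ratio w q r)\<^sup>2)) * c r)"
    proof (rule sum.mono_neutral_right[OF fin(1)])
      show "I \<subseteq> E" by (auto simp: I_def)
      show "\<forall>r\<in>E - I. of_real (chain_ratio w q r / (1 + (chain_ratio w q r)\<^sup>2)) * c r = 0"
        using q chain_ratio_nonzero_trans[of w _ q p] chain_ratio_sym[of w q]
        by (fastforce simp: I_def J_def)
    qed
    also have "\<dots> = (\<Sum>r\<in>I. of_real (chain_node w q) * (d r / of_real (Z r + Z q)))"
    proof (rule sum.cong[OF refl])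
      fix r assume r: "r \<in> I"
      have "chain_ratio w q r \<noteq> 0" using rel r q by blast
      from cauchy_kernel_chain_ratio[OF w(1) this]
      show "of_real (chain_ratio w q r / (1 + (chain_ratio w q r)\<^sup>2)) * c r
          = of_real (chain_node w q) * (d r / of_real (Z r + Z q))"
        by (simp add: d_def Z_def add.commute mult.commute mult.left_commute)
    qed
    also have "\<dots> = of_real (chain_node w q) * (\<Sum>r\<in>I. d r / of_real (Z r + Z q))"
      by (simp add: sum_distrib_left)
    finally show "(\<Sum>r\<in>I. d r / of_real (Z r + Z q)) = 0"
      using chain_node_pos[of w q] w(1) by simp
  qed (use pos in auto)
  then show ?thesis using chain_node_pos[of w p] w(1) by (simp add: d_def)
qed

text \<open>A saturated set \<open>B\<close> is a disjoint union of classes, so the inequalities for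
  the classes add up. It is applied to a block formed by merging smaller blocks.\<close>

lemma card_le_if_card_classes_le:
  assumes r: "equiv S r" and fin: "finite S" and sub: "E \<subseteq> S" "F \<subseteq> S"
    and card: "\<And>p. p \<in> S \<Longrightarrow> card (E \<inter> r `` {p}) \<le> card (F \<inter> r `` {p})"
    and B: "B \<subseteq> S" "\<And>p q. p \<in> B \<Longrightarrow> (p, q) \<in> r \<Longrightarrow> q \<in> B"
  shows "card (E \<inter> B) \<le> card (F \<inter> B)"
proof -
  have finB: "finite B" using fin B(1) finite_subset by blast
  have un: "B = (\<Union>C\<in>(\<lambda>p. r `` {p}) ` B. C)"
    using B equiv_class_self[OF r] by (intro subset_antisym) blast+
  have split: "card (D \<inter> B) = (\<Sum>C\<in>(\<lambda>p. r `` {p}) ` B. card (D \<inter> C))" if "D \<subseteq> S" for D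
  proof -
    have "D \<inter> B = (\<Union>C\<in>(\<lambda>p. r `` {p}) ` B. D \<inter> C)" using un by blast
    moreover have "card (\<Union>C\<in>(\<lambda>p. r `` {p}) ` B. D \<inter> C) = (\<Sum>C\<in>(\<lambda>p. r `` {p}) ` B. card (D \<inter> C))"
    proof (rule card_UN_disjoint)
      show "finite ((\<lambda>p. r `` {p}) ` B)" using finB by simp
      show "\<forall>C\<in>(\<lambda>p. r `` {p}) ` B. finite (D \<inter> C)"
        using that fin finite_subset by blast
      show "\<forall>C\<in>(\<lambda>p. r `` {p}) ` B. \<forall>C'\<in>(\<lambda>p. r `` {p}) ` B. C \<noteq> C' \<longrightarrow> D \<inter> C \<inter> (D \<inter> C') = {}"
        using quotient_disj[OF r] B(1) by (fastforce intro: quotientI)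
    qed
    ultimately show ?thesis by simp
  qed
  show ?thesis
    unfolding split[OF sub(1)] split[OF sub(2)] using card B(1) by (intro sum_mono) auto
qed

section \<open>Block diagonal matrices\<close>

lemma diag_block_mat_carrier:
  assumes "\<And>z. z \<in> set zs \<Longrightarrow> f z \<in> carrier_mat (d z) (d z)"
  shows "diag_block_mat (map f zs) \<in> carrier_mat (sum_list (map d zs)) (sum_list (map d zs))"
proof -
  have "map dim_row (map f zs) = map d zs" "map dim_col (map f zs) = map d zs"
    using assms by (force intro: map_cong)+
  then show ?thesis by (intro carrier_matI) (simp_all only: dim_diag_block_mat)
qed

lemma diag_block_mat_Cons:
  assumes "f z \<in> carrier_mat (d z) (d z)" "\<And>z. z \<in> set zs \<Longrightarrow> f z \<in> carrier_mat (d z) (d z)"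
  shows "diag_block_mat (map f (z # zs)) = four_block_mat (f z)
    (0\<^sub>m (d z) (sum_list (map d zs))) (0\<^sub>m (sum_list (map d zs)) (d z)) (diag_block_mat (map f zs))"
  using assms(1) diag_block_mat_carrier[of zs f d, OF assms(2)] by (auto simp: Let_def)

text \<open>A function fixing 0 preserves the zero blocks off the diagonal. This lets scalar
  functions act entrywise on elements of the algebra.\<close>

lemma diag_block_mat_map_mat:
  assumes "\<phi> 0 = 0"
  shows "map_mat \<phi> (diag_block_mat (map f zs)) = diag_block_mat (map (\<lambda>z. map_mat \<phi> (f z)) zs)"
proof (induction zs)
  case (Cons z zs)
  have zero: "map_mat \<phi> (0\<^sub>m k l) = 0\<^sub>m k l" for k l using assms by auto
  let ?D = "diag_block_mat (map f zs)"
  have "dim_row ?D = dim_row (diag_block_mat (map (\<lambda>z. map_mat \<phi> (f z)) zs))"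
    "dim_col ?D = dim_col (diag_block_mat (map (\<lambda>z. map_mat \<phi> (f z)) zs))"
    by (simp_all flip: Cons.IH)
  moreover have "map_mat \<phi> (four_block_mat (f z) (0\<^sub>m (dim_row (f z)) (dim_col ?D))
      (0\<^sub>m (dim_row ?D) (dim_col (f z))) ?D)
    = four_block_mat (map_mat \<phi> (f z)) (0\<^sub>m (dim_row (f z)) (dim_col ?D))
      (0\<^sub>m (dim_row ?D) (dim_col (f z))) (map_mat \<phi> ?D)"
    by (subst map_four_block_mat[of _ "dim_row (f z)" "dim_col (f z)" _ "dim_col ?D" _ "dim_row ?D"])
      (auto simp: zero)
  ultimately show ?case by (simp add: Let_def Cons.IH)
qed auto

lemma diag_block_mat_mult:
  fixes f g :: "'z \<Rightarrow> 'c :: semiring_1 mat"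
  assumes "\<And>z. z \<in> set zs \<Longrightarrow> f z \<in> carrier_mat (d z) (d z)"
    and "\<And>z. z \<in> set zs \<Longrightarrow> g z \<in> carrier_mat (d z) (d z)"
  shows "diag_block_mat (map f zs) * diag_block_mat (map g zs) = diag_block_mat (map (\<lambda>z. f z * g z) zs)"
  using assms
proof (induction zs)
  case (Cons z zs)
  define N where "N = sum_list (map d zs)"
  have D: "diag_block_mat (map f zs) \<in> carrier_mat N N" "diag_block_mat (map g zs) \<in> carrier_mat N N"
    unfolding N_def using Cons.prems by (auto intro!: diag_block_mat_carrier)
  have z: "f z \<in> carrier_mat (d z) (d z)" "g z \<in> carrier_mat (d z) (d z)" using Cons.prems by auto
  have IH: "diag_block_mat (map f zs) * diag_block_mat (map g zs) = diag_block_mat (map (\<lambda>z. f z * g z) zs)"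
    using Cons by auto
  have "diag_block_mat (map f (z # zs)) * diag_block_mat (map g (z # zs))
      = four_block_mat (f z) (0\<^sub>m (d z) N) (0\<^sub>m N (d z)) (diag_block_mat (map f zs))
        * four_block_mat (g z) (0\<^sub>m (d z) N) (0\<^sub>m N (d z)) (diag_block_mat (map g zs))"
    unfolding N_def using Cons.prems
    by (subst (1 2) diag_block_mat_Cons[where d = d]) auto
  also have "\<dots> = four_block_mat (f z * g z) (0\<^sub>m (d z) N) (0\<^sub>m N (d z))
      (diag_block_mat (map f zs) * diag_block_mat (map g zs))"
    using z D by (subst mult_four_block_mat[of _ "d z" "d z" _ N _ N _ _ "d z" _ N]) auto
  also have "\<dots> = diag_block_mat (map (\<lambda>z. f z * g z) (z # zs))"
    unfolding IH N_def using Cons.prems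
    by (subst diag_block_mat_Cons[where d = d]) (auto intro!: mult_carrier_mat)
  finally show ?case .
qed auto

lemma diag_block_mat_add:
  fixes f g :: "'z \<Rightarrow> 'c :: semiring_1 mat"
  assumes "\<And>z. z \<in> set zs \<Longrightarrow> f z \<in> carrier_mat (d z) (d z)"
    and "\<And>z. z \<in> set zs \<Longrightarrow> g z \<in> carrier_mat (d z) (d z)"
  shows "diag_block_mat (map f zs) + diag_block_mat (map g zs) = diag_block_mat (map (\<lambda>z. f z + g z) zs)"
  using assms
proof (induction zs)
  case (Cons z zs)
  define N where "N = sum_list (map d zs)"
  have D: "diag_block_mat (map f zs) \<in> carrier_mat N N" "diag_block_mat (map g zs) \<in> carrier_mat N N"
    unfolding N_def using Cons.prems by (auto intro!: diag_block_mat_carrier)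
  have z: "f z \<in> carrier_mat (d z) (d z)" "g z \<in> carrier_mat (d z) (d z)" using Cons.prems by auto
  have IH: "diag_block_mat (map f zs) + diag_block_mat (map g zs) = diag_block_mat (map (\<lambda>z. f z + g z) zs)"
    using Cons by auto
  have "diag_block_mat (map f (z # zs)) + diag_block_mat (map g (z # zs))
      = four_block_mat (f z) (0\<^sub>m (d z) N) (0\<^sub>m N (d z)) (diag_block_mat (map f zs))
        + four_block_mat (g z) (0\<^sub>m (d z) N) (0\<^sub>m N (d z)) (diag_block_mat (map g zs))"
    unfolding N_def using Cons.prems
    by (subst (1 2) diag_block_mat_Cons[where d = d]) auto
  also have "\<dots> = four_block_mat (f z + g z) (0\<^sub>m (d z) N) (0\<^sub>m N (d z))
      (diag_block_mat (map f zs) + diag_block_mat (map g zs))"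
    using z D by (subst add_four_block_mat[of _ "d z" "d z" _ N _ N]) auto
  also have "\<dots> = diag_block_mat (map (\<lambda>z. f z + g z) (z # zs))"
    unfolding IH N_def using Cons.prems
    by (subst diag_block_mat_Cons[where d = d]) auto
  finally show ?case .
qed auto

lemma diag_block_mat_one:
  "diag_block_mat (map (\<lambda>z. 1\<^sub>m (d z)) zs) = (1\<^sub>m (sum_list (map d zs)) :: 'c :: semiring_1 mat)"
  by (induction zs) (auto simp: Let_def)

section \<open>Chain matrices and domination inside blocks\<close>

definition chain_mat :: "(nat \<Rightarrow> real) \<Rightarrow> nat \<Rightarrow> complex mat" where
  "chain_mat w n = mat n n (\<lambda>(p, q). of_real (chain_ratio w p q))"

lemma chain_mat_simps [simp]:
  "chain_mat w n \<in> carrier_mat n n" "dim_row (chain_mat w n) = n" "dim_col (chain_mat w n) = n"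
  "p < n \<Longrightarrow> q < n \<Longrightarrow> chain_mat w n $$ (p, q) = of_real (chain_ratio w p q)"
  by (auto simp: chain_mat_def)

text \<open>Indices below \<open>n\<close> are linked by the \<open>n - 1\<close> weights
  \<open>w k\<close> with \<open>Suc k < n\<close>; all later weights are free.\<close>

lemma chain_mat_cong:
  assumes "\<And>k. Suc k < n \<Longrightarrow> w k = w' k"
  shows "chain_mat w n = chain_mat w' n"
proof (rule eq_matI)
  fix p q assume "p < dim_row (chain_mat w' n)" "q < dim_col (chain_mat w' n)"
  then have pq: "p < n" "q < n" by auto
  then have "chain_ratio w p q = chain_ratio w' p q"
    unfolding chain_ratio_def by (intro prod.cong refl assms) auto
  then show "chain_mat w n $$ (p, q) = chain_mat w' n $$ (p, q)" using pq by simp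
qed auto

definition is_chain_mat :: "nat \<Rightarrow> complex mat \<Rightarrow> bool" where
  "is_chain_mat n M \<longleftrightarrow> (\<exists>w. (\<forall>k. 0 \<le> w k \<and> w k < 1) \<and> M = chain_mat w n)"

lemma is_chain_mat_carrier: "is_chain_mat n M \<Longrightarrow> M \<in> carrier_mat n n"
  by (auto simp: is_chain_mat_def)

text \<open>The two weight sequences are concatenated with a zero weight at the junction, which
  makes every ratio across it vanish.\<close>

lemma is_chain_mat_four_block:
  assumes "is_chain_mat n A" "is_chain_mat m D"
  shows "is_chain_mat (n + m) (four_block_mat A (0\<^sub>m n m) (0\<^sub>m m n) D)"
proof -
  obtain u where u: "\<forall>k. 0 \<le> u k \<and> u k < 1" "A = chain_mat u n"
    using assms(1) unfolding is_chain_mat_def by blast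
  obtain v where v: "\<forall>k. 0 \<le> v k \<and> v k < 1" "D = chain_mat v m"
    using assms(2) unfolding is_chain_mat_def by blast
  \<comment> \<open>The junction weight has index \<open>n - 1\<close>, linking the last index of
    the first summand to the first index of the second. For \<open>n = 0\<close> no junction arises
    and \<open>w\<close> is just \<open>v\<close>.\<close>
  define w where "w k = (if Suc k < n then u k else if Suc k = n then 0 else v (k - n))" for k
  have "four_block_mat A (0\<^sub>m n m) (0\<^sub>m m n) D = chain_mat w (n + m)"
  proof (rule eq_matI)
    fix p q assume "p < dim_row (chain_mat w (n + m))" "q < dim_col (chain_mat w (n + m))"
    then have pq: "p < n + m" "q < n + m" by auto
    have 1: "chain_ratio w p q = chain_ratio u p q" if "p < n" "q < n"
      unfolding chain_ratio_def using that by (intro prod.cong) (auto simp: w_def)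
    have 2: "chain_ratio w p q = 0" if "min p q < n" "n \<le> max p q"
    proof -
      have "n - 1 \<in> {min p q..<max p q}" "w (n - 1) = 0" using that by (auto simp: w_def)
      then show ?thesis unfolding chain_ratio_def by (intro prod_zero) auto
    qed
    have 3: "chain_ratio w p q = chain_ratio v (p - n) (q - n)" if "n \<le> p" "n \<le> q"
    proof -
      have "chain_ratio w p q = prod w {min (p - n) (q - n) + n..<max (p - n) (q - n) + n}"
        unfolding chain_ratio_def using that by (intro prod.cong) auto
      also have "\<dots> = (\<Prod>k = min (p - n) (q - n)..<max (p - n) (q - n). w (k + n))"
        by (rule prod.shift_bounds_nat_ivl)
      also have "\<dots> = chain_ratio v (p - n) (q - n)"
        unfolding chain_ratio_def by (intro prod.cong) (auto simp: w_def)
      finally show ?thesis .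
    qed
    show "four_block_mat A (0\<^sub>m n m) (0\<^sub>m m n) D $$ (p, q) = chain_mat w (n + m) $$ (p, q)"
      using pq 1 2 3 by (auto simp: u(2) v(2))
  qed (auto simp: u(2) v(2))
  moreover have "0 \<le> w k \<and> w k < 1" for k using u v by (auto simp: w_def)
  ultimately show ?thesis unfolding is_chain_mat_def by blast
qed

lemma is_chain_mat_diag_block:
  assumes "\<And>z. z \<in> set zs \<Longrightarrow> is_chain_mat (d z) (f z)"
  shows "is_chain_mat (sum_list (map d zs)) (diag_block_mat (map f zs))"
  using assms
proof (induction zs)
  case Nil
  have "(0\<^sub>m 0 0 :: complex mat) = chain_mat (\<lambda>_. 0) 0" by (intro eq_matI) auto
  then show ?case unfolding is_chain_mat_def by (auto intro!: exI[of _ "\<lambda>_. 0"])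
next
  case (Cons z zs)
  have "is_chain_mat (d z + sum_list (map d zs)) (four_block_mat (f z)
    (0\<^sub>m (d z) (sum_list (map d zs))) (0\<^sub>m (sum_list (map d zs)) (d z)) (diag_block_mat (map f zs)))"
    using Cons by (intro is_chain_mat_four_block) auto
  then show ?case
    using Cons.prems is_chain_mat_carrier
    by (subst diag_block_mat_Cons[where d = d]) auto
qed

text \<open>For a chain matrix \<open>W\<close>, the index \<open>r\<close> lies in the block of \<open>p\<close> iff \<open>W $$ (r, p) \<noteq> 0\<close>.\<close>

definition block_dominated :: "real \<Rightarrow> nat \<Rightarrow> complex mat \<Rightarrow> complex mat \<Rightarrow> complex mat \<Rightarrow> bool" where
  "block_dominated \<epsilon> n A B W \<longleftrightarrow>
     (\<forall>p<n. card {r. r < n \<and> \<epsilon> \<le> Re (A $$ (r, r)) \<and> W $$ (r, p) \<noteq> 0}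
          \<le> card {q. q < n \<and> B $$ (q, q) \<noteq> 0 \<and> W $$ (q, p) \<noteq> 0})"

text \<open>The zero corners of the sum of \<open>W1\<close> and \<open>W2\<close> keep the block of
  \<open>p\<close> inside the summand that contains \<open>p\<close>, so both counts are those of
  that summand, up to a shift by \<open>n\<close>.\<close>

lemma block_dominated_four_block:
  assumes A: "A1 \<in> carrier_mat n n" "A2 \<in> carrier_mat m m"
    and B: "B1 \<in> carrier_mat n n" "B2 \<in> carrier_mat m m"
    and W: "W1 \<in> carrier_mat n n" "W2 \<in> carrier_mat m m"
    and dom: "block_dominated \<epsilon> n A1 B1 W1" "block_dominated \<epsilon> m A2 B2 W2"
  shows "block_dominated \<epsilon> (n + m) (four_block_mat A1 (0\<^sub>m n m) (0\<^sub>m m n) A2)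
    (four_block_mat B1 (0\<^sub>m n m) (0\<^sub>m m n) B2) (four_block_mat W1 (0\<^sub>m n m) (0\<^sub>m m n) W2)"
    (is "block_dominated _ _ ?A ?B ?W")
proof -
  \<comment> \<open>The condition on diagonal entries is left as a predicate \<open>P\<close>, so
    that one count serves both the threshold for \<open>A\<close> and nonvanishing for
    \<open>B\<close>.\<close>
  have low: "card {r. r < n + m \<and> P (M $$ (r, r)) \<and> ?W $$ (r, p) \<noteq> 0}
      = card {r. r < n \<and> P (M1 $$ (r, r)) \<and> W1 $$ (r, p) \<noteq> 0}"
    if "p < n" "M = four_block_mat M1 (0\<^sub>m n m) (0\<^sub>m m n) M2" "M1 \<in> carrier_mat n n" "M2 \<in> carrier_mat m m"
    for p P and M M1 M2 :: "complex mat"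
    using that W by (intro arg_cong[where f = card]) (auto split: if_splits)
  have high: "card {r. r < n + m \<and> P (M $$ (r, r)) \<and> ?W $$ (r, p) \<noteq> 0}
      = card {r. r < m \<and> P (M2 $$ (r, r)) \<and> W2 $$ (r, p - n) \<noteq> 0}"
    if "n \<le> p" "p < n + m" "M = four_block_mat M1 (0\<^sub>m n m) (0\<^sub>m m n) M2"
      "M1 \<in> carrier_mat n n" "M2 \<in> carrier_mat m m"
    for p P and M M1 M2 :: "complex mat"
  proof -
    have "{r. r < n + m \<and> P (M $$ (r, r)) \<and> ?W $$ (r, p) \<noteq> 0}
        = (\<lambda>r. r + n) ` {r. r < m \<and> P (M2 $$ (r, r)) \<and> W2 $$ (r, p - n) \<noteq> 0}" (is "?L = ?R")
    proof (intro subset_antisym subsetI)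
      fix r assume r: "r \<in> ?L"
      then have "n \<le> r" using that W by (auto split: if_splits)
      then have "r = (r - n) + n" "r - n \<in> {r. r < m \<and> P (M2 $$ (r, r)) \<and> W2 $$ (r, p - n) \<noteq> 0}"
        using r that W by (auto split: if_splits)
      then show "r \<in> ?R" by (rule image_eqI)
    next
      fix r assume "r \<in> ?R"
      then show "r \<in> ?L" using that W by auto
    qed
    then show ?thesis by (simp add: card_image)
  qed
  show ?thesis
    unfolding block_dominated_def
  proof (intro allI impI)
    fix p assume p: "p < n + m"
    show "card {r. r < n + m \<and> \<epsilon> \<le> Re (?A $$ (r, r)) \<and> ?W $$ (r, p) \<noteq> 0}
        \<le> card {q. q < n + m \<and> ?B $$ (q, q) \<noteq> 0 \<and> ?W $$ (q, p) \<noteq> 0}"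
    proof (cases "p < n")
      case True
      show ?thesis
        using dom(1) True low[OF True refl A, of "\<lambda>z. \<epsilon> \<le> Re z"] low[OF True refl B, of "\<lambda>z. z \<noteq> 0"]
        unfolding block_dominated_def by simp
    next
      case False
      then have "n \<le> p" by simp
      from high[OF this p refl A, of "\<lambda>z. \<epsilon> \<le> Re z"] high[OF this p refl B, of "\<lambda>z. z \<noteq> 0"]
      show ?thesis using dom(2) False p unfolding block_dominated_def by simp
    qed
  qed
qed

lemma block_dominated_diag_block:
  assumes "\<And>z. z \<in> set zs \<Longrightarrow> a z \<in> carrier_mat (d z) (d z)"
    and "\<And>z. z \<in> set zs \<Longrightarrow> b z \<in> carrier_mat (d z) (d z)"
    and "\<And>z. z \<in> set zs \<Longrightarrow> f z \<in> carrier_mat (d z) (d z)"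
    and "\<And>z. z \<in> set zs \<Longrightarrow> block_dominated \<epsilon> (d z) (a z) (b z) (f z)"
  shows "block_dominated \<epsilon> (sum_list (map d zs))
    (diag_block_mat (map a zs)) (diag_block_mat (map b zs)) (diag_block_mat (map f zs))"
  using assms
proof (induction zs)
  case Nil
  then show ?case by (simp add: block_dominated_def)
next
  case (Cons z zs)
  have "block_dominated \<epsilon> (d z + sum_list (map d zs))
     (four_block_mat (a z) (0\<^sub>m (d z) (sum_list (map d zs))) (0\<^sub>m (sum_list (map d zs)) (d z)) (diag_block_mat (map a zs)))
     (four_block_mat (b z) (0\<^sub>m (d z) (sum_list (map d zs))) (0\<^sub>m (sum_list (map d zs)) (d z)) (diag_block_mat (map b zs)))
     (four_block_mat (f z) (0\<^sub>m (d z) (sum_list (map d zs))) (0\<^sub>m (sum_list (map d zs)) (d z)) (diag_block_mat (map f zs)))"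
    using Cons by (intro block_dominated_four_block diag_block_mat_carrier) auto
  then show ?case
    using Cons.prems diag_block_mat_Cons[of a z d zs] diag_block_mat_Cons[of b z d zs]
      diag_block_mat_Cons[of f z d zs] by simp
qed

text \<open>If nonzero weights stay nonzero, every new block is a union of old ones and the
  inequalities add up; losing indices for \<open>A\<close> or gaining indices for \<open>B\<close>
  only helps. This yields both openness of domination and its survival when weights are
  raised.\<close>

lemma block_dominated_chain_mono:
  assumes dom: "block_dominated \<epsilon> n A B (chain_mat w n)"
    and A: "\<And>r. r < n \<Longrightarrow> \<epsilon> \<le> Re (A' $$ (r, r)) \<Longrightarrow> \<epsilon> \<le> Re (A $$ (r, r))"
    and B: "\<And>q. q < n \<Longrightarrow> B $$ (q, q) \<noteq> 0 \<Longrightarrow> B' $$ (q, q) \<noteq> 0"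
    and w: "\<And>k. Suc k < n \<Longrightarrow> w k \<noteq> 0 \<Longrightarrow> w' k \<noteq> 0"
  shows "block_dominated \<epsilon> n A' B' (chain_mat w' n)"
  unfolding block_dominated_def
proof (intro allI impI)
  fix p assume p: "p < n"
  define R where "R = {(i, j). i < n \<and> j < n \<and> chain_ratio w i j \<noteq> 0}"
  define E where "E = {r. r < n \<and> \<epsilon> \<le> Re (A $$ (r, r))}"
  define F where "F = {q. q < n \<and> B $$ (q, q) \<noteq> 0}"
  \<comment> \<open>\<open>C\<close> is the new block of \<open>p\<close>, while the classes of
    \<open>R\<close> are the old blocks.\<close>
  define C where "C = {r. r < n \<and> chain_ratio w' r p \<noteq> 0}"
  have R: "equiv {..<n} R"
  proof (rule equivI)
    show "R \<subseteq> {..<n} \<times> {..<n}" by (auto simp: R_def)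
    show "refl_on {..<n} R" by (auto simp: R_def refl_on_def)
    show "sym R" by (auto simp: R_def sym_def chain_ratio_sym)
    show "trans R" using chain_ratio_nonzero_trans by (auto simp: R_def trans_def)
  qed
  have "card {r. r < n \<and> \<epsilon> \<le> Re (A' $$ (r, r)) \<and> chain_mat w' n $$ (r, p) \<noteq> 0} \<le> card (E \<inter> C)"
    using p A by (intro card_mono) (auto simp: E_def C_def)
  also have "\<dots> \<le> card (F \<inter> C)"
  proof (rule card_le_if_card_classes_le[OF R])
    show "C \<subseteq> {..<n}" "E \<subseteq> {..<n}" "F \<subseteq> {..<n}" by (auto simp: C_def E_def F_def)
    fix i assume "i \<in> {..<n}"
    then have i: "i < n" by simp
    have "E \<inter> R `` {i} = {r. r < n \<and> \<epsilon> \<le> Re (A $$ (r, r)) \<and> chain_mat w n $$ (r, i) \<noteq> 0}"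
      "F \<inter> R `` {i} = {q. q < n \<and> B $$ (q, q) \<noteq> 0 \<and> chain_mat w n $$ (q, i) \<noteq> 0}"
      using i by (auto simp: E_def F_def R_def chain_ratio_sym)
    then show "card (E \<inter> R `` {i}) \<le> card (F \<inter> R `` {i})"
      using dom i unfolding block_dominated_def by simp
  next
    fix i j assume i: "i \<in> C" and ij: "(i, j) \<in> R"
    have "chain_ratio w' i j \<noteq> 0"
      using ij w unfolding R_def by (auto simp: chain_ratio_nonzero_iff)
    then show "j \<in> C"
      using i ij chain_ratio_nonzero_trans[of w' j i p] chain_ratio_sym[of w' i j]
      by (auto simp: C_def R_def)
  qed auto
  also have "\<dots> \<le> card {q. q < n \<and> B' $$ (q, q) \<noteq> 0 \<and> chain_mat w' n $$ (q, p) \<noteq> 0}"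
    using p B by (intro card_mono) (auto simp: F_def C_def)
  finally show "card {r. r < n \<and> \<epsilon> \<le> Re (A' $$ (r, r)) \<and> chain_mat w' n $$ (r, p) \<noteq> 0}
      \<le> card {q. q < n \<and> B' $$ (q, q) \<noteq> 0 \<and> chain_mat w' n $$ (q, p) \<noteq> 0}" .
qed

lemma block_dominated_connected:
  assumes "card {r. r < n \<and> \<epsilon> \<le> Re (A $$ (r, r))} \<le> card {q. q < n \<and> B $$ (q, q) \<noteq> 0}"
    and "\<And>k. w k \<noteq> 0"
  shows "block_dominated \<epsilon> n A B (chain_mat w n)"
proof -
  have "chain_ratio w r p \<noteq> 0" for r p using assms(2) by (simp add: chain_ratio_nonzero_iff)
  then have "{r. r < n \<and> \<epsilon> \<le> Re (A $$ (r, r)) \<and> chain_mat w n $$ (r, p) \<noteq> 0} = {r. r < n \<and> \<epsilon> \<le> Re (A $$ (r, r))}"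
    "{q. q < n \<and> B $$ (q, q) \<noteq> 0 \<and> chain_mat w n $$ (q, p) \<noteq> 0} = {q. q < n \<and> B $$ (q, q) \<noteq> 0}"
    if "p < n" for p using that by auto
  then show ?thesis using assms(1) by (simp add: block_dominated_def)
qed

section \<open>Extending chain matrices from a closed set\<close>

lemma continuous_map_compose_UNIV:
  "continuous_map X euclidean f \<Longrightarrow> continuous_on UNIV g \<Longrightarrow> continuous_map X euclidean (\<lambda>x. g (f x))"
  using continuous_map_compose[of X euclidean f euclidean g] by (simp add: o_def)

lemma continuous_map_times_complex:
  fixes f g :: "'a \<Rightarrow> complex"
  assumes "continuous_map X euclidean f" "continuous_map X euclidean g"
  shows "continuous_map X euclidean (\<lambda>x. f x * g x)"
  using assms by (simp add: continuous_map_atin tendsto_mult)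

lemma continuous_map_prod_complex:
  fixes f :: "'a \<Rightarrow> 'i \<Rightarrow> complex"
  assumes "finite I" "\<And>i. i \<in> I \<Longrightarrow> continuous_map X euclidean (\<lambda>x. f x i)"
  shows "continuous_map X euclidean (\<lambda>x. prod (f x) I)"
  using assms by (simp add: continuous_map_atin tendsto_prod)

lemma continuous_map_inverse_complex:
  fixes f :: "'a \<Rightarrow> complex"
  assumes "continuous_map X euclidean f" "\<And>x. x \<in> topspace X \<Longrightarrow> f x \<noteq> 0"
  shows "continuous_map X euclidean (\<lambda>x. inverse (f x))"
  using assms by (simp add: continuous_map_atin tendsto_inverse)

text \<open>Along the extension the weights can only become more positive, so blocks merge; by
  monotonicity the domination near \<open>S\<close> survives, and away from \<open>S\<close> there is a single block.\<close>

lemma chain_mat_extension: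
  fixes X :: "'a topology" and A B W\<^sub>0 :: "'a \<Rightarrow> complex mat"
  assumes X: "compact_space X" "Hausdorff_space X" and S: "closedin X S"
    and A: "\<And>r. r < n \<Longrightarrow> continuous_map X euclidean (\<lambda>x. A x $$ (r, r))"
    and B: "\<And>r. r < n \<Longrightarrow> continuous_map X euclidean (\<lambda>x. B x $$ (r, r))"
    and chain: "\<And>y. y \<in> S \<Longrightarrow> is_chain_mat n (W\<^sub>0 y)"
    and dom: "\<And>y. y \<in> S \<Longrightarrow> block_dominated \<epsilon> n (A y) (B y) (W\<^sub>0 y)"
    and cont: "\<And>r s. r < n \<Longrightarrow> s < n \<Longrightarrow>
      continuous_map (subtopology X S) euclidean (\<lambda>y. W\<^sub>0 y $$ (r, s))"
    and rank: "\<And>x. x \<in> topspace X - S \<Longrightarrow>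
      card {r. r < n \<and> \<epsilon> \<le> Re (A x $$ (r, r))} \<le> card {q. q < n \<and> B x $$ (q, q) \<noteq> 0}"
  obtains W where "\<And>x. x \<in> topspace X \<Longrightarrow> is_chain_mat n (W x)"
    "\<And>x. x \<in> topspace X \<Longrightarrow> block_dominated \<epsilon> n (A x) (B x) (W x)"
    "\<And>y. y \<in> S \<Longrightarrow> W y = W\<^sub>0 y"
    "\<And>r s. r < n \<Longrightarrow> s < n \<Longrightarrow> continuous_map X euclidean (\<lambda>x. W x $$ (r, s))"
proof -
  have normal: "normal_space X"
    using X compact_Hausdorff_or_regular_imp_normal_space by blast
  have S_sub: "S \<subseteq> topspace X" using S closedin_subset by blast
  \<comment> \<open>A single weight is the ratio of neighbouring indices, so the weights can be read
    off continuously from the superdiagonal.\<close>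
  define u where "u k y = Re (W\<^sub>0 y $$ (k, Suc k))" for k y
  have u: "0 \<le> u k y \<and> u k y < 1" if "Suc k < n" "y \<in> S" for k y
    using chain[OF that(2)] that(1) unfolding is_chain_mat_def u_def
    by (auto simp: chain_ratio_def)
  have W\<^sub>0: "W\<^sub>0 y = chain_mat (\<lambda>k. u k y) n" if y: "y \<in> S" for y
  proof -
    obtain w where w: "\<forall>k. 0 \<le> w k \<and> w k < 1" "W\<^sub>0 y = chain_mat w n"
      using chain[OF y] unfolding is_chain_mat_def by blast
    have "w k = u k y" if "Suc k < n" for k
      using that by (simp add: u_def w(2) chain_ratio_def)
    then show ?thesis unfolding w(2) by (rule chain_mat_cong)
  qed
  \<comment> \<open>Tietze's theorem holds for any nonempty real interval as target; the half-open
    one preserves the strict bound below 1.\<close>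
  have "\<exists>g. continuous_map X euclideanreal g \<and> g ` topspace X \<subseteq> {0..<1} \<and> (\<forall>x\<in>S. g x = u k x)"
    if "Suc k < n" for k
  proof -
    have "continuous_map (subtopology X S) euclideanreal (u k)"
      unfolding u_def using cont[of k "Suc k"] that
      by (intro continuous_map_compose_UNIV[where g = Re]) (auto intro: continuous_intros)
    moreover have "u k ` S \<subseteq> {0..<1}" using u[OF that] by auto
    moreover have "is_interval {0..<1::real}" "{0..<1::real} \<noteq> {}"
      by (auto simp: is_interval_1)
    ultimately show ?thesis
      using Tietze_extension_realinterval[OF normal S, of "{0..<1}" "u k"] by metis
  qed
  then obtain v where v_cont: "\<And>k. Suc k < n \<Longrightarrow> continuous_map X euclideanreal (v k)"
    and v_range: "\<And>k. Suc k < n \<Longrightarrow> v k ` topspace X \<subseteq> {0..<1}"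
    and v_eq: "\<And>k x. Suc k < n \<Longrightarrow> x \<in> S \<Longrightarrow> v k x = u k x"
    by metis
  have v: "0 \<le> v k x" "v k x < 1" if "Suc k < n" "x \<in> topspace X" for k x
    using v_range[OF that(1)] that(2) by (auto simp: image_subset_iff)
  have W\<^sub>0': "W\<^sub>0 y = chain_mat (\<lambda>k. v k y) n" if "y \<in> S" for y
    unfolding W\<^sub>0[OF that] using v_eq that by (intro chain_mat_cong) simp
  \<comment> \<open>On \<open>G\<close> the extended weights already dominate. It contains
    \<open>S\<close>, and it is open because strict inequalities and nonvanishing persist
    nearby.\<close>
  define G where "G = {x \<in> topspace X. block_dominated \<epsilon> n (A x) (B x) (chain_mat (\<lambda>k. v k x) n)}"
  have "openin X G"
  proof (subst openin_subopen, intro ballI)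
    fix x\<^sub>0 assume x\<^sub>0: "x\<^sub>0 \<in> G"
    \<comment> \<open>The three sets record what must persist from \<open>x\<^sub>0\<close>. Each is
      stated as an implication, so it is the whole space when there is nothing to preserve.\<close>
    define T1 where "T1 r = {x \<in> topspace X. Re (A x\<^sub>0 $$ (r, r)) < \<epsilon> \<longrightarrow> Re (A x $$ (r, r)) < \<epsilon>}" for r
    define T2 where "T2 r = {x \<in> topspace X. B x\<^sub>0 $$ (r, r) \<noteq> 0 \<longrightarrow> B x $$ (r, r) \<noteq> 0}" for r
    define T3 where "T3 r = {x \<in> topspace X. Suc r < n \<longrightarrow> v r x\<^sub>0 \<noteq> 0 \<longrightarrow> v r x \<noteq> 0}" for r
    have "openin X (T1 r)" if "r < n" for r
    proof (cases "Re (A x\<^sub>0 $$ (r, r)) < \<epsilon>")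
      case True
      have "continuous_map X euclideanreal (\<lambda>x. Re (A x $$ (r, r)))"
        using A[OF that] by (intro continuous_map_compose_UNIV[where g = Re]) (auto intro: continuous_intros)
      from openin_continuous_map_preimage[OF this, of "{..<\<epsilon>}"] True show ?thesis
        by (simp add: T1_def)
    qed (simp add: T1_def)
    moreover have "openin X (T2 r)" if "r < n" for r
    proof (cases "B x\<^sub>0 $$ (r, r) \<noteq> 0")
      case True
      from openin_continuous_map_preimage[OF B[OF that], of "- {0}"] True show ?thesis
        by (simp add: T2_def open_Compl)
    qed (simp add: T2_def)
    moreover have "openin X (T3 r)" for r
    proof (cases "Suc r < n \<and> v r x\<^sub>0 \<noteq> 0")
      case True
      from openin_continuous_map_preimage[OF v_cont, of r "- {0}"] True show ?thesis
        by (simp add: T3_def open_Compl)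
    next
      case False
      then have "T3 r = topspace X" by (auto simp: T3_def)
      then show ?thesis by simp
    qed
    ultimately have "openin X ((\<Inter>r\<in>{..<n}. T1 r \<inter> T2 r \<inter> T3 r) \<inter> topspace X)"
      by (intro openin_INT) auto
    moreover have "x\<^sub>0 \<in> (\<Inter>r\<in>{..<n}. T1 r \<inter> T2 r \<inter> T3 r) \<inter> topspace X"
      using x\<^sub>0 by (simp add: G_def T1_def T2_def T3_def)
    moreover have "(\<Inter>r\<in>{..<n}. T1 r \<inter> T2 r \<inter> T3 r) \<inter> topspace X \<subseteq> G"
    proof
      fix x assume x: "x \<in> (\<Inter>r\<in>{..<n}. T1 r \<inter> T2 r \<inter> T3 r) \<inter> topspace X"
      have "block_dominated \<epsilon> n (A x) (B x) (chain_mat (\<lambda>k. v k x) n)"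
      proof (rule block_dominated_chain_mono)
        show "block_dominated \<epsilon> n (A x\<^sub>0) (B x\<^sub>0) (chain_mat (\<lambda>k. v k x\<^sub>0) n)"
          using x\<^sub>0 by (simp add: G_def)
        show "\<epsilon> \<le> Re (A x\<^sub>0 $$ (r, r))" if "r < n" "\<epsilon> \<le> Re (A x $$ (r, r))" for r
          using x that by (force simp: T1_def)
        show "B x $$ (r, r) \<noteq> 0" if "r < n" "B x\<^sub>0 $$ (r, r) \<noteq> 0" for r
          using x that by (force simp: T2_def)
        show "v r x \<noteq> 0" if "Suc r < n" "v r x\<^sub>0 \<noteq> 0" for r
          using x that by (force simp: T3_def)
      qed
      then show "x \<in> G" using x by (simp add: G_def)
    qed
    ultimately show "\<exists>T. openin X T \<and> x\<^sub>0 \<in> T \<and> T \<subseteq> G" by blast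
  qed
  then have "closedin X (topspace X - G)" by blast
  moreover have "disjnt S (topspace X - G)"
    using dom W\<^sub>0' S_sub by (auto simp: disjnt_def G_def)
  ultimately obtain g :: "'a \<Rightarrow> real" where g: "continuous_map X (top_of_set {0..1}) g"
    "g ` S \<subseteq> {0}" "g ` (topspace X - G) \<subseteq> {1}"
    using Urysohn_lemma[OF normal S, of "topspace X - G" 0 1] by auto
  have g_cont: "continuous_map X euclideanreal g" and g_range: "\<And>x. x \<in> topspace X \<Longrightarrow> 0 \<le> g x \<and> g x \<le> 1"
    using g(1) by (auto simp: continuous_map_in_subtopology image_subset_iff Pi_iff)
  \<comment> \<open>Each weight moves towards 1 by the fraction \<open>g x / 2\<close> of its
    distance. It is unchanged on \<open>S\<close>, never decreases, stays below 1, and is at least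
    1/2 where \<open>g = 1\<close>. The default 1/2 keeps the irrelevant weights nonzero, as the
    one-block criterion asks for all \<open>k\<close>.\<close>
  define w where "w x k = (if Suc k < n then v k x + g x * (1 - v k x) / 2 else 1/2)" for x k
  have w: "0 \<le> w x k" "w x k < 1" "Suc k < n \<Longrightarrow> v k x \<le> w x k"
    if x: "x \<in> topspace X" for x k
  proof -
    have *: "0 \<le> w x k \<and> w x k < 1 \<and> v k x \<le> w x k" if k: "Suc k < n"
    proof -
      have "0 \<le> g x * (1 - v k x)" "g x * (1 - v k x) \<le> 1 - v k x"
        using v[OF k x] g_range[OF x] by (auto intro: mult_left_le_one_le)
      moreover have "w x k = v k x + g x * (1 - v k x) / 2" using k by (simp add: w_def)
      ultimately show ?thesis using v[OF k x] by linarith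
    qed
    have "w x k = 1/2" if "\<not> Suc k < n" using that by (simp add: w_def)
    with * show "0 \<le> w x k" "w x k < 1" "Suc k < n \<Longrightarrow> v k x \<le> w x k"
      by (cases "Suc k < n"; simp)+
  qed
  show thesis
  proof
    show "is_chain_mat n (chain_mat (w x) n)" if "x \<in> topspace X" for x
      unfolding is_chain_mat_def using w[OF that] by (intro exI[of _ "w x"]) simp
    show "block_dominated \<epsilon> n (A x) (B x) (chain_mat (w x) n)" if x: "x \<in> topspace X" for x
    proof (cases "x \<in> G")
      case True
      then have "block_dominated \<epsilon> n (A x) (B x) (chain_mat (\<lambda>k. v k x) n)" by (simp add: G_def)
      then show ?thesis
      proof (rule block_dominated_chain_mono)
        fix k assume k: "Suc k < n" "v k x \<noteq> 0"
        then show "w x k \<noteq> 0" using w(3)[OF x k(1)] v(1)[OF k(1) x] by simp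
      qed auto
    next
      case False
      then have gx: "g x = 1" "x \<notin> S" using g x dom W\<^sub>0' by (auto simp: G_def)
      show ?thesis
      proof (rule block_dominated_connected)
        show "card {r. r < n \<and> \<epsilon> \<le> Re (A x $$ (r, r))} \<le> card {q. q < n \<and> B x $$ (q, q) \<noteq> 0}"
          using rank x gx(2) by blast
        show "w x k \<noteq> 0" for k
          using v(1)[of k x] x by (auto simp: w_def gx field_simps)
      qed
    qed
    show "chain_mat (w y) n = W\<^sub>0 y" if "y \<in> S" for y
      unfolding W\<^sub>0'[OF that] using g(2) that by (intro chain_mat_cong) (auto simp: w_def)
    show "continuous_map X euclidean (\<lambda>x. chain_mat (w x) n $$ (r, s))" if "r < n" "s < n" for r s
    proof -
      have "continuous_map X euclideanreal (\<lambda>x. w x k)" for k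
      proof (cases "Suc k < n")
        case True
        then show ?thesis
          using v_cont[OF True] g_cont unfolding w_def by (auto intro!: continuous_intros)
      qed (simp add: w_def)
      then have "continuous_map X euclideanreal (\<lambda>x. chain_ratio (w x) r s)"
        unfolding chain_ratio_def by (intro continuous_map_prod) auto
      then have "continuous_map X euclidean (\<lambda>x. complex_of_real (chain_ratio (w x) r s))"
        by (rule continuous_map_compose_UNIV) (auto intro: continuous_intros)
      then show ?thesis using that by simp
    qed
  qed
qed

section \<open>Matrix inverses and the compression\<close>

text \<open>The adjugate formula shows the entries of the inverse as polynomials in the entries
  divided by the determinant, hence as continuous functions where the determinant is
  nonzero.\<close>

definition inv_mat :: "complex mat \<Rightarrow> complex mat" where
  "inv_mat M = inverse (Determinant.det M) \<cdot>\<^sub>m adj_mat M"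

lemma inv_mat:
  assumes "M \<in> carrier_mat n n" "Determinant.det M \<noteq> 0"
  shows "inv_mat M \<in> carrier_mat n n" "M * inv_mat M = 1\<^sub>m n" "inv_mat M * M = 1\<^sub>m n"
proof -
  note adj = adj_mat[OF assms(1)]
  show "inv_mat M \<in> carrier_mat n n" unfolding inv_mat_def using adj(1) by simp
  have "inverse (Determinant.det M) \<cdot>\<^sub>m (Determinant.det M \<cdot>\<^sub>m 1\<^sub>m n) = 1\<^sub>m n"
    using assms(2) by (intro eq_matI) auto
  then show "M * inv_mat M = 1\<^sub>m n" "inv_mat M * M = 1\<^sub>m n"
    unfolding inv_mat_def using adj
    by (simp_all add: mult_smult_distrib[OF assms(1) adj(1)] mult_smult_assoc_mat[OF adj(1) assms(1)])
qed

lemma continuous_map_det: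
  fixes F :: "'a \<Rightarrow> complex mat"
  assumes "\<And>x. x \<in> topspace X \<Longrightarrow> F x \<in> carrier_mat n n"
    and "\<And>r s. r < n \<Longrightarrow> s < n \<Longrightarrow> continuous_map X euclidean (\<lambda>x. F x $$ (r, s))"
  shows "continuous_map X euclidean (\<lambda>x. Determinant.det (F x))"
proof -
  have "continuous_map X euclidean
      (\<lambda>x. \<Sum>p\<in>{p. p permutes {0..<n}}. signof p * (\<Prod>i = 0..<n. F x $$ (i, p i)))"
    using assms(2) permutes_in_image
    by (intro continuous_map_sum continuous_map_times_complex continuous_map_prod_complex)
      (fastforce simp: finite_permutations)+
  then show ?thesis
    by (rule continuous_map_eq) (simp add: det_def'[OF assms(1)])
qed

lemma continuous_map_inv_mat:
  fixes F :: "'a \<Rightarrow> complex mat"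
  assumes F: "\<And>x. x \<in> topspace X \<Longrightarrow> F x \<in> carrier_mat n n"
    and cont: "\<And>r s. r < n \<Longrightarrow> s < n \<Longrightarrow> continuous_map X euclidean (\<lambda>x. F x $$ (r, s))"
    and det: "\<And>x. x \<in> topspace X \<Longrightarrow> Determinant.det (F x) \<noteq> 0"
    and rs: "r < n" "s < n"
  shows "continuous_map X euclidean (\<lambda>x. inv_mat (F x) $$ (r, s))"
proof -
  have "continuous_map X euclidean (\<lambda>x. Determinant.det (mat_delete (F x) s r))"
  proof (rule continuous_map_det[where n = "n - 1"])
    show "mat_delete (F x) s r \<in> carrier_mat (n - 1) (n - 1)" if "x \<in> topspace X" for x
      using F[OF that] by (simp add: mat_delete_def)
    fix i j assume ij: "i < n - 1" "j < n - 1"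
    have "continuous_map X euclidean
        (\<lambda>x. F x $$ (if i < s then i else Suc i, if j < r then j else Suc j))"
      using ij by (intro cont) auto
    then show "continuous_map X euclidean (\<lambda>x. mat_delete (F x) s r $$ (i, j))"
    proof (rule continuous_map_eq)
      fix x assume "x \<in> topspace X"
      from carrier_matD[OF F[OF this]] ij
      show "F x $$ (if i < s then i else Suc i, if j < r then j else Suc j)
          = mat_delete (F x) s r $$ (i, j)" by (simp add: mat_delete_def)
    qed
  qed
  then have "continuous_map X euclidean
      (\<lambda>x. inverse (Determinant.det (F x)) * ((- 1) ^ (s + r) * Determinant.det (mat_delete (F x) s r)))"
    using continuous_map_det[OF F cont] det
    by (intro continuous_map_times_complex continuous_map_inverse_complex) auto
  then show ?thesis
  proof (rule continuous_map_eq)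
    fix x assume "x \<in> topspace X"
    from carrier_matD[OF F[OF this]] rs
    show "inverse (Determinant.det (F x)) * ((- 1) ^ (s + r) * Determinant.det (mat_delete (F x) s r))
        = inv_mat (F x) $$ (r, s)"
      by (simp add: inv_mat_def adj_mat_def cofactor_def)
  qed
qed

text \<open>The block sum of the inverses is a left inverse of the block sum, and such an inverse is
  unique. This is the gluing condition for inverses.\<close>

lemma diag_block_mat_inverse:
  assumes F: "\<And>z. z \<in> set zs \<Longrightarrow> f z \<in> carrier_mat (d z) (d z)"
    and det: "\<And>z. z \<in> set zs \<Longrightarrow> Determinant.det (f z) \<noteq> 0" "Determinant.det (diag_block_mat (map f zs)) \<noteq> 0"
  shows "inv_mat (diag_block_mat (map f zs)) = diag_block_mat (map (\<lambda>z. inv_mat (f z)) zs)"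
proof -
  let ?M = "diag_block_mat (map f zs)" and ?I = "diag_block_mat (map (\<lambda>z. inv_mat (f z)) zs)"
  define N where "N = sum_list (map d zs)"
  have inv: "inv_mat (f z) \<in> carrier_mat (d z) (d z)" "inv_mat (f z) * f z = 1\<^sub>m (d z)" if "z \<in> set zs" for z
    using inv_mat[OF F det(1)] that by auto
  have M: "?M \<in> carrier_mat N N" and I: "?I \<in> carrier_mat N N"
    unfolding N_def using F inv(1) by (auto intro!: diag_block_mat_carrier)
  have "?I * ?M = diag_block_mat (map (\<lambda>z. inv_mat (f z) * f z) zs)"
    using inv(1) F by (rule diag_block_mat_mult)
  also have "map (\<lambda>z. inv_mat (f z) * f z) zs = map (\<lambda>z. 1\<^sub>m (d z)) zs"
    using inv(2) by (intro map_cong) auto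
  also have "diag_block_mat (map (\<lambda>z. 1\<^sub>m (d z) :: complex mat) zs) = 1\<^sub>m N"
    unfolding N_def by (rule diag_block_mat_one)
  finally have IM: "?I * ?M = 1\<^sub>m N" .
  note M' = inv_mat[OF M det(2)]
  have "inv_mat ?M = (?I * ?M) * inv_mat ?M" using M'(1) by (simp add: IM)
  also have "\<dots> = ?I * (?M * inv_mat ?M)" by (rule assoc_mult_mat[OF I M M'(1)])
  also have "\<dots> = ?I" using I by (simp add: M'(2))
  finally show ?thesis .
qed

lemma diagonal_mult_left:
  fixes D M :: "complex mat"
  assumes "D \<in> carrier_mat n n" "M \<in> carrier_mat n n" "diagonal_mat D" "r < n" "s < n"
  shows "(D * M) $$ (r, s) = D $$ (r, r) * M $$ (r, s)"
proof -
  have "(D * M) $$ (r, s) = (\<Sum>l<n. D $$ (r, l) * M $$ (l, s))"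
    using assms by (auto simp: scalar_prod_def lessThan_atLeast0 intro!: sum.cong)
  also have "\<dots> = (\<Sum>l<n. if l = r then D $$ (r, r) * M $$ (r, s) else 0)"
    using assms by (intro sum.cong) (auto simp: diagonal_mat_def)
  finally show ?thesis using assms by simp
qed

lemma diagonal_mult_right:
  fixes D M :: "complex mat"
  assumes "D \<in> carrier_mat n n" "M \<in> carrier_mat n n" "diagonal_mat D" "r < n" "s < n"
  shows "(M * D) $$ (r, s) = M $$ (r, s) * D $$ (s, s)"
proof -
  have "(M * D) $$ (r, s) = (\<Sum>l<n. M $$ (r, l) * D $$ (l, s))"
    using assms by (auto simp: scalar_prod_def lessThan_atLeast0 intro!: sum.cong)
  also have "\<dots> = (\<Sum>l<n. if l = s then M $$ (r, s) * D $$ (s, s) else 0)"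
    using assms by (intro sum.cong) (auto simp: diagonal_mat_def)
  finally show ?thesis using assms by simp
qed

text \<open>Pairing the equation with \<open>v\<close> gives a vanishing sum of nonnegative terms.\<close>

lemma quadratic_form_kernel:
  fixes h \<beta> :: "nat \<Rightarrow> real" and V :: "nat \<Rightarrow> nat \<Rightarrow> real" and v :: "nat \<Rightarrow> complex"
  assumes h: "\<And>r. r < n \<Longrightarrow> h r \<le> 1" and \<beta>: "\<And>q. q < n \<Longrightarrow> 0 \<le> \<beta> q"
    and sym: "\<And>p q. V p q = V q p"
    and eq: "\<And>r. r < n \<Longrightarrow>
      of_real (h r) * (\<Sum>q<n. of_real (V r q * \<beta> q) * (\<Sum>s<n. of_real (V q s * h s) * v s))
      + of_real (1 - h r) * v r = 0"
  shows "\<And>q. q < n \<Longrightarrow> \<beta> q \<noteq> 0 \<Longrightarrow> (\<Sum>s<n. of_real (V q s * h s) * v s) = 0"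
    and "\<And>r. r < n \<Longrightarrow> h r \<noteq> 1 \<Longrightarrow> v r = 0"
proof -
  define y where "y q = (\<Sum>s<n. of_real (V q s * h s) * v s)" for q
  have "0 = (\<Sum>r<n. cnj (v r) * (of_real (h r) * (\<Sum>q<n. of_real (V r q * \<beta> q) * y q) + of_real (1 - h r) * v r))"
    using eq by (simp add: y_def)
  also have "\<dots> = (\<Sum>r<n. \<Sum>q<n. cnj (v r) * of_real (h r) * of_real (V r q * \<beta> q) * y q)
      + (\<Sum>r<n. of_real (1 - h r) * (cnj (v r) * v r))"
    by (simp add: sum.distrib distrib_left sum_distrib_left mult_ac)
  also have "(\<Sum>r<n. \<Sum>q<n. cnj (v r) * of_real (h r) * of_real (V r q * \<beta> q) * y q)
      = (\<Sum>q<n. \<Sum>r<n. cnj (v r) * of_real (h r) * of_real (V r q * \<beta> q) * y q)"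
    by (rule sum.swap)
  also have "\<dots> = (\<Sum>q<n. of_real (\<beta> q) * (cnj (y q) * y q))"
  proof (rule sum.cong[OF refl])
    fix q
    \<comment> \<open>Since \<open>V\<close> is real and symmetric and \<open>h\<close> is real, the
      sum over \<open>r\<close> is the conjugate of \<open>y q\<close>.\<close>
    have "cnj (y q) = (\<Sum>r<n. cnj (v r) * of_real (h r) * of_real (V r q))"
      by (simp add: y_def sym[of q] mult_ac)
    then show "(\<Sum>r<n. cnj (v r) * of_real (h r) * of_real (V r q * \<beta> q) * y q)
        = of_real (\<beta> q) * (cnj (y q) * y q)"
      by (simp add: sum_distrib_left sum_distrib_right mult_ac)
  qed
  also have "(\<Sum>q<n. of_real (\<beta> q) * (cnj (y q) * y q)) + (\<Sum>r<n. of_real (1 - h r) * (cnj (v r) * v r))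
      = of_real ((\<Sum>q<n. \<beta> q * (cmod (y q))\<^sup>2) + (\<Sum>r<n. (1 - h r) * (cmod (v r))\<^sup>2))"
    by (simp add: complex_norm_square[symmetric] mult.commute[of "cnj _"] flip: of_real_power)
  finally have sum: "(\<Sum>q<n. \<beta> q * (cmod (y q))\<^sup>2) + (\<Sum>r<n. (1 - h r) * (cmod (v r))\<^sup>2) = 0"
    by (metis of_real_eq_0_iff)
  have nonneg: "0 \<le> \<beta> q * (cmod (y q))\<^sup>2" "0 \<le> (1 - h q) * (cmod (v q))\<^sup>2" if "q < n" for q
    using h[OF that] \<beta>[OF that] by simp_all
  have "(\<Sum>q<n. \<beta> q * (cmod (y q))\<^sup>2) = 0" "(\<Sum>r<n. (1 - h r) * (cmod (v r))\<^sup>2) = 0"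
    using sum sum_nonneg[of "{..<n}" "\<lambda>q. \<beta> q * (cmod (y q))\<^sup>2"]
      sum_nonneg[of "{..<n}" "\<lambda>r. (1 - h r) * (cmod (v r))\<^sup>2"] nonneg by (auto intro: antisym)
  then have zero: "\<beta> q * (cmod (y q))\<^sup>2 = 0" "(1 - h q) * (cmod (v q))\<^sup>2 = 0" if "q < n" for q
    using sum_nonneg_0[of "{..<n}" "\<lambda>q. \<beta> q * (cmod (y q))\<^sup>2" q]
      sum_nonneg_0[of "{..<n}" "\<lambda>r. (1 - h r) * (cmod (v r))\<^sup>2" q] nonneg that by simp_all
  show "(\<Sum>s<n. of_real (V q s * h s) * v s) = 0" if "q < n" "\<beta> q \<noteq> 0" for q
    using zero(1)[OF that(1)] that(2) by (simp add: y_def)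
  show "v r = 0" if "r < n" "h r \<noteq> 1" for r
    using zero(2)[OF that(1)] that(2) by simp
qed

text \<open>Applied entrywise to \<open>a\<close>, \<open>cutoff\<close> and \<open>sqrt_excess\<close> give the elements \<open>h\<close> and \<open>k\<close>
  of the introduction; \<open>cauchy_entry\<close> turns chain ratios into the entries of \<open>V\<close>, and
  \<open>compression\<close> is \<open>T\<close>.\<close>

definition cutoff :: "real \<Rightarrow> complex \<Rightarrow> complex" where
  "cutoff \<epsilon> z = of_real (min 1 (Re z / \<epsilon>))"

definition sqrt_excess :: "real \<Rightarrow> complex \<Rightarrow> complex" where
  "sqrt_excess \<epsilon> z = of_real (sqrt (max (Re z - \<epsilon>) 0))"

definition cauchy_entry :: "complex \<Rightarrow> complex" where
  "cauchy_entry z = of_real (Re z / (1 + (Re z)\<^sup>2))"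

definition compression :: "real \<Rightarrow> complex mat \<Rightarrow> complex mat \<Rightarrow> complex mat \<Rightarrow> complex mat" where
  "compression \<epsilon> A B W =
     map_mat (cutoff \<epsilon>) A * map_mat cauchy_entry W * B * (map_mat cauchy_entry W * map_mat (cutoff \<epsilon>) A)
     + (1\<^sub>m (dim_row A) + map_mat (\<lambda>z. - cutoff \<epsilon> z) A)"

section \<open>The compression at a single point: invertibility and the sandwich identity\<close>

context
  fixes \<epsilon> :: real and m :: nat and A B W :: "complex mat" and \<alpha> \<beta> w :: "nat \<Rightarrow> real"
  assumes \<epsilon>: "0 < \<epsilon>"
    and A: "A \<in> carrier_mat m m" "diagonal_mat A" "\<And>r. r < m \<Longrightarrow> A $$ (r, r) = of_real (\<alpha> r)"
    and B: "B \<in> carrier_mat m m" "diagonal_mat B" "\<And>r. r < m \<Longrightarrow> B $$ (r, r) = of_real (\<beta> r)"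
    and nonneg: "\<And>r. r < m \<Longrightarrow> 0 \<le> \<alpha> r" "\<And>r. r < m \<Longrightarrow> 0 \<le> \<beta> r"
    and w: "\<And>k. 0 \<le> w k" "\<And>k. w k < 1" and W: "W = chain_mat w m"
    and dom: "block_dominated \<epsilon> m A B W"
begin

private definition "H = map_mat (cutoff \<epsilon>) A"
text \<open>This is \<open>1 - h\<close>, written as a sum so that closure under addition and
  entrywise maps later covers it.\<close>

private definition "N = 1\<^sub>m m + map_mat (\<lambda>z. - cutoff \<epsilon> z) A"
private definition "V = map_mat cauchy_entry W"
private definition "R = map_mat (sqrt_excess \<epsilon>) A"
private definition "h r = min 1 (\<alpha> r / \<epsilon>)"
private definition "c p q = chain_ratio w p q / (1 + (chain_ratio w p q)\<^sup>2)"

private lemma W_carrier: "W \<in> carrier_mat m m"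
  and W_entry: "r < m \<Longrightarrow> s < m \<Longrightarrow> W $$ (r, s) = of_real (chain_ratio w r s)"
  by (simp_all add: W)

private lemma carrier: "H \<in> carrier_mat m m" "N \<in> carrier_mat m m" "V \<in> carrier_mat m m" "R \<in> carrier_mat m m"
  using A(1) W_carrier by (simp_all add: H_def N_def V_def R_def)

private lemma entries:
  assumes "r < m" "s < m"
  shows "H $$ (r, s) = (if r = s then of_real (h r) else 0)"
    and "N $$ (r, s) = (if r = s then of_real (1 - h r) else 0)"
    and "V $$ (r, s) = of_real (c r s)"
    and "R $$ (r, s) = (if r = s then of_real (sqrt (max (\<alpha> r - \<epsilon>) 0)) else 0)"
  using A assms \<epsilon> W_carrier
  by (auto simp: H_def N_def V_def R_def W_entry h_def c_def cutoff_def sqrt_excess_def cauchy_entry_def diagonal_mat_def)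

private lemma diagonal: "diagonal_mat H" "diagonal_mat N" "diagonal_mat R"
  using carrier entries by (auto simp: diagonal_mat_def)

private lemma compression_eq: "compression \<epsilon> A B W = H * V * B * (V * H) + N"
  using A(1) by (simp add: compression_def H_def V_def N_def)

lemma compression_carrier: "compression \<epsilon> A B W \<in> carrier_mat m m"
  unfolding compression_eq using carrier B(1) by simp

private lemma HVB: "r < m \<Longrightarrow> q < m \<Longrightarrow> (H * V * B) $$ (r, q) = of_real (h r * c r q * \<beta> q)"
  using carrier B
  by (simp add: diagonal_mult_right[where n = m] diagonal_mult_left[where n = m] entries diagonal
      del: index_mult_mat)

private lemma VH: "q < m \<Longrightarrow> s < m \<Longrightarrow> (V * H) $$ (q, s) = of_real (c q s * h s)"
  using carrier by (simp add: diagonal_mult_right[where n = m] entries diagonal del: index_mult_mat)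

text \<open>For a null vector \<open>x\<close>, the quadratic form argument gives
  \<open>x = 0\<close> wherever \<open>h \<noteq> 1\<close>, and \<open>V h x = 0\<close> in the
  rows \<open>F\<close>. On the remaining indices \<open>E\<close> one has \<open>h = 1\<close>, so
  the columns \<open>E\<close> of \<open>V\<close> combine to zero in the rows \<open>F\<close>;
  block domination makes that submatrix injective.\<close>

lemma det_compression: "Determinant.det (compression \<epsilon> A B W) \<noteq> 0"
proof
  assume "Determinant.det (compression \<epsilon> A B W) = 0"
  then obtain v where v: "v \<in> carrier_vec m" "v \<noteq> 0\<^sub>v m" "compression \<epsilon> A B W *\<^sub>v v = 0\<^sub>v m"
    using det_0_iff_vec_prod_zero_field[OF compression_carrier] by blast
  define x where "x s = vec_index v s" for s
  have eq: "of_real (h r) * (\<Sum>q<m. of_real (c r q * \<beta> q) * (\<Sum>s<m. of_real (c q s * h s) * x s))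
      + of_real (1 - h r) * x r = 0" if r: "r < m" for r
  proof -
    have c1: "H * V * B \<in> carrier_mat m m" and c2: "V * H \<in> carrier_mat m m" using carrier B by auto
    have mv: "vec_index (M *\<^sub>v u) r = (\<Sum>q<m. M $$ (r, q) * vec_index u q)"
      if "M \<in> carrier_mat m m" "u \<in> carrier_vec m" "r < m" for M :: "complex mat" and u r
      using that by (auto simp: scalar_prod_def lessThan_atLeast0 intro!: sum.cong)
    have "compression \<epsilon> A B W *\<^sub>v v = (H * V * B) *\<^sub>v ((V * H) *\<^sub>v v) + N *\<^sub>v v"
      unfolding compression_eq using c1 c2 carrier v(1)
      by (subst add_mult_distrib_mat_vec[of _ m m]) (auto simp: assoc_mult_mat_vec[OF c1 c2 v(1)])
    then have z: "(H * V * B) *\<^sub>v ((V * H) *\<^sub>v v) + N *\<^sub>v v = 0\<^sub>v m" using v(3) by (simp only:)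
    have "0 = vec_index ((H * V * B) *\<^sub>v ((V * H) *\<^sub>v v) + N *\<^sub>v v) r"
      unfolding z using r by simp
    also have "\<dots> = vec_index ((H * V * B) *\<^sub>v ((V * H) *\<^sub>v v)) r + vec_index (N *\<^sub>v v) r"
      using carrier r by simp
    also have "vec_index ((H * V * B) *\<^sub>v ((V * H) *\<^sub>v v)) r
        = (\<Sum>q<m. of_real (h r * c r q * \<beta> q) * (\<Sum>s<m. of_real (c q s * h s) * x s))"
      using mv[OF c1 _ r, of "(V * H) *\<^sub>v v"] mv[OF c2 v(1)] c2 v(1)
      by (simp add: HVB VH r x_def del: index_mult_mat index_mult_mat_vec)
    also have "vec_index (N *\<^sub>v v) r = of_real (1 - h r) * x r"
      using mv[OF carrier(2) v(1) r] r
      by (simp add: entries x_def if_distrib[of "\<lambda>z. z * _"] del: index_mult_mat_vec cong: if_cong)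
    finally show ?thesis by (simp add: sum_distrib_left mult.assoc)
  qed
  have sym: "c p q = c q p" for p q by (simp add: c_def chain_ratio_sym)
  have h1: "h r \<le> 1" for r by (simp add: h_def)
  have kernel: "\<beta> q \<noteq> 0 \<Longrightarrow> (\<Sum>s<m. of_real (c q s * h s) * x s) = 0"
    "h q \<noteq> 1 \<Longrightarrow> x q = 0" if "q < m" for q
    by (rule quadratic_form_kernel[where n = m and h = h and \<beta> = \<beta> and V = c and v = x];
        (rule h1 | erule nonneg(2) | rule sym | erule eq | rule that | assumption))+
  define E where "E = {r. r < m \<and> \<epsilon> \<le> \<alpha> r}"
  define F where "F = {q. q < m \<and> \<beta> q \<noteq> 0}"
  \<comment> \<open>The cutoff satisfies \<open>h r = 1\<close> exactly when
    \<open>\<epsilon> \<le> \<alpha> r\<close>, so \<open>h \<noteq> 1\<close> off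
    \<open>E\<close>.\<close>
  have outside: "x r = 0" if "r < m" "r \<notin> E" for r
    using kernel(2)[OF that(1)] that \<epsilon> by (auto simp: E_def h_def min_def field_simps split: if_splits)
  have inside: "h r = 1" if "r \<in> E" for r using that \<epsilon> by (simp add: E_def h_def)
  have "x p = 0" if p: "p \<in> E" for p
  proof (rule chain_kernel_injective[of w E F])
    show "finite E" "finite F" by (auto simp: E_def F_def)
    show "card {r\<in>E. chain_ratio w r p \<noteq> 0} \<le> card {q\<in>F. chain_ratio w q p \<noteq> 0}" if p: "p \<in> E" for p
    proof -
      have "{r\<in>E. chain_ratio w r p \<noteq> 0} = {r. r < m \<and> \<epsilon> \<le> Re (A $$ (r, r)) \<and> W $$ (r, p) \<noteq> 0}"
        "{q\<in>F. chain_ratio w q p \<noteq> 0} = {q. q < m \<and> B $$ (q, q) \<noteq> 0 \<and> W $$ (q, p) \<noteq> 0}"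
        using p by (auto simp: E_def F_def W A(3) B(3))
      then show ?thesis using dom p by (simp add: block_dominated_def E_def)
    qed
    fix q assume q: "q \<in> F"
    have "(\<Sum>p\<in>E. of_real (c q p) * x p) = (\<Sum>s<m. of_real (c q s * h s) * x s)"
      using inside outside by (intro sum.mono_neutral_cong_left) (auto simp: E_def)
    also have "\<dots> = 0" using kernel(1) q by (simp add: F_def)
    finally show "(\<Sum>p\<in>E. of_real (chain_ratio w q p / (1 + (chain_ratio w q p)\<^sup>2)) * x p) = 0"
      by (simp add: c_def)
  qed (use w p in auto)
  then have "x r = 0" if "r < m" for r using outside that by blast
  then have "v = 0\<^sub>v m" using v(1) by (intro eq_vecI) (auto simp: x_def)
  then show False using v(2) by simp
qed

text \<open>\<open>R\<close> is supported where \<open>\<alpha> > \<epsilon>\<close>, and there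
  \<open>h = 1\<close>. Thus \<open>H R = R\<close> and \<open>N R = 0\<close>, so
  \<open>T R = H V B V R\<close>, and applying the inverse of \<open>T\<close> recovers
  \<open>R\<close>.\<close>

lemma compression_sandwich:
  "map_mat (sqrt_excess \<epsilon>) A * (inv_mat (compression \<epsilon> A B W)
      * (map_mat (cutoff \<epsilon>) A * map_mat cauchy_entry W)) * B
      * (map_mat cauchy_entry W * map_mat (sqrt_excess \<epsilon>) A)
    = map_mat (sqrt_excess \<epsilon>) A * map_mat (sqrt_excess \<epsilon>) A"
  unfolding H_def[symmetric] V_def[symmetric] R_def[symmetric]
proof -
  define T where "T = compression \<epsilon> A B W"
  note inv = inv_mat[OF compression_carrier det_compression, folded T_def]
  have HR: "H * R = R"
  proof (rule eq_matI)
    fix r s assume "r < dim_row R" "s < dim_col R"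
    then have rs: "r < m" "s < m" using carrier by auto
    show "(H * R) $$ (r, s) = R $$ (r, s)"
      using \<epsilon> rs carrier diagonal
      by (auto simp: diagonal_mult_left[where n = m] entries h_def min_def max_def field_simps
          simp del: index_mult_mat)
  qed (use carrier in auto)
  have NR: "N * R = 0\<^sub>m m m"
  proof (rule eq_matI)
    fix r s assume "r < dim_row (0\<^sub>m m m)" "s < dim_col (0\<^sub>m m m)"
    then have rs: "r < m" "s < m" by auto
    show "(N * R) $$ (r, s) = 0\<^sub>m m m $$ (r, s)"
      using \<epsilon> rs carrier diagonal
      by (auto simp: diagonal_mult_left[where n = m] entries h_def min_def max_def field_simps
          simp del: index_mult_mat)
  qed (use carrier in auto)
  note car = carrier B(1) inv(1)
  have "T * R = H * V * B * (V * H) * R + N * R"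
    unfolding T_def compression_eq using car by (intro add_mult_distrib_mat) auto
  also have "H * V * B * (V * H) * R = H * V * B * (V * R)"
    using car by (simp add: HR assoc_mult_mat[of _ m m _ m _ m])
  also have "\<dots> + N * R = H * V * B * (V * R)"
  proof -
    have "H * V * B \<in> carrier_mat m m" "V * R \<in> carrier_mat m m" using car by auto
    from mult_carrier_mat[OF this] show ?thesis unfolding NR by (rule right_add_zero_mat)
  qed
  finally have TR: "T * R = H * V * B * (V * R)" .
  have "R * (inv_mat T * (H * V)) * B * (V * R) = R * (inv_mat T * (H * V * B * (V * R)))"
    using car by (simp add: assoc_mult_mat[of _ m m _ m _ m])
  also have "inv_mat T * (H * V * B * (V * R)) = inv_mat T * T * R"
    unfolding TR[symmetric]
    by (rule assoc_mult_mat[symmetric, OF inv(1) compression_carrier[folded T_def] carrier(4)])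
  also have "\<dots> = R" using car by (simp add: inv(3))
  finally show "R * (inv_mat (compression \<epsilon> A B W) * (H * V)) * B * (V * R) = R * R"
    by (simp only: T_def)
qed

lemma sqrt_excess_square:
  assumes "r < m" "s < m"
  shows "(map_mat (sqrt_excess \<epsilon>) A * map_mat (sqrt_excess \<epsilon>) A) $$ (r, s)
    = (if r = s then of_real (max (\<alpha> r - \<epsilon>) 0) else 0)"
  unfolding R_def[symmetric] diagonal_mult_left[OF carrier(4,4) diagonal(3) assms]
  using assms by (auto simp: entries simp flip: of_real_mult)

end

section \<open>Scalar functions, and rank, norm and positivity read off diagonal entries\<close>

lemma continuous_on_cutoff: "0 < \<epsilon> \<Longrightarrow> continuous_on UNIV (cutoff \<epsilon>)"
  unfolding cutoff_def by (intro continuous_intros) auto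

lemma continuous_on_sqrt_excess: "continuous_on UNIV (sqrt_excess \<epsilon>)"
  unfolding sqrt_excess_def by (intro continuous_intros)

lemma continuous_on_cauchy_entry: "continuous_on UNIV cauchy_entry"
  unfolding cauchy_entry_def by (intro continuous_intros) (auto simp: add_nonneg_eq_0_iff)

lemma cutoff_0 [simp]: "cutoff \<epsilon> 0 = 0"
  by (simp add: cutoff_def)

lemma sqrt_excess_0: "0 < \<epsilon> \<Longrightarrow> sqrt_excess \<epsilon> 0 = 0"
  by (simp add: sqrt_excess_def)

lemma cauchy_entry_0 [simp]: "cauchy_entry 0 = 0"
  by (simp add: cauchy_entry_def)

text \<open>The columns with nonzero diagonal entry are multiples of distinct unit vectors, and
  every other column is zero. They therefore form a maximal independent set of columns.\<close>

lemma rank_diagonal: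
  fixes A :: "complex mat"
  assumes A: "A \<in> carrier_mat n n" and diag: "diagonal_mat A"
  shows "vec_space.rank n A = card {r. r < n \<and> A $$ (r, r) \<noteq> 0}"
proof -
  interpret vec_space "TYPE(complex)" n .
  define I where "I = {r. r < n \<and> A $$ (r, r) \<noteq> 0}"
  define U where "U = col A ` I"
  have index: "vec_index (col A j) i = (if i = j then A $$ (i, i) else 0)" if "i < n" "j < n" for i j
    using that A diag by (auto simp: diagonal_mat_def)
  have inj: "inj_on (col A) I"
  proof (rule inj_onI)
    fix i j assume "i \<in> I" "j \<in> I" "col A i = col A j"
    then show "i = j" using index[of i i] index[of i j] by (auto simp: I_def split: if_splits)
  qed
  have cols: "set (cols A) = col A ` {..<n}" using A by (auto simp: cols_def)
  have cols_carrier: "set (cols A) \<subseteq> carrier_vec n" using A cols_dim by blast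
  have U_sub: "U \<subseteq> set (cols A)" unfolding U_def cols by (auto simp: I_def)
  have U_fin: "finite U" by (simp add: U_def I_def)
  have indpt: "lin_indpt U"
  proof
    assume "lin_dep U"
    then obtain a u where au: "lincomb a U = 0\<^sub>v n" "u \<in> U" "a u \<noteq> 0"
      using finite_lin_dep[OF U_fin] U_sub cols_carrier by auto
    obtain i where i: "i \<in> I" "u = col A i" using au(2) by (auto simp: U_def)
    then have i_n: "i < n" by (simp add: I_def)
    have "0 = vec_index (lincomb a U) i" using au(1) i_n by simp
    also have "\<dots> = (\<Sum>x\<in>U. a x * vec_index x i)"
      using lincomb_index[OF i_n] U_sub cols_carrier by blast
    also have "\<dots> = (\<Sum>j\<in>I. a (col A j) * vec_index (col A j) i)"
      unfolding U_def by (simp add: sum.reindex[OF inj])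
    also have "\<dots> = (\<Sum>j\<in>I. if j = i then a u * A $$ (i, i) else 0)"
      using index i_n i(2) by (intro sum.cong) (auto simp: I_def)
    also have "\<dots> = a u * A $$ (i, i)" using i(1) by (simp add: I_def)
    finally show False using au(3) i(1) by (simp add: I_def)
  qed
  have "maximal U (\<lambda>T. T \<subseteq> set (cols A) \<and> lin_indpt T)"
    unfolding maximal_def
  proof (intro conjI allI impI)
    fix T assume T: "U \<subseteq> T \<and> T \<subseteq> set (cols A) \<and> lin_indpt T"
    have "0\<^sub>v n \<notin> T" using vs_zero_lin_dep[of T] T cols_carrier by auto
    have "T \<subseteq> U"
    proof
      fix t assume t: "t \<in> T"
      then obtain j where j: "j < n" "t = col A j" using T cols by auto
      have "j \<in> I"
      proof (rule ccontr)
        assume "j \<notin> I"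
        then have "A $$ (j, j) = 0" using j by (simp add: I_def)
        then have "vec_index (col A j) i = vec_index (0\<^sub>v n) i" if "i < n" for i
          using index[OF that j(1)] that by auto
        then have "col A j = 0\<^sub>v n" by (intro eq_vecI) (use A in simp_all)
        then show False using \<open>0\<^sub>v n \<notin> T\<close> t j by simp
      qed
      then show "t \<in> U" using j by (simp add: U_def)
    qed
    then show "T = U" using T by blast
  qed (use U_sub indpt in auto)
  then have "rank A = card U" by (rule rank_card_indpt[OF A])
  also have "card U = card I" unfolding U_def by (rule card_image[OF inj])
  finally show ?thesis by (simp only: I_def)
qed

text \<open>The matrix multiplies each coordinate by a scalar of modulus at most
  \<open>c\<close>.\<close>

lemma op_norm_diagonal_le:
  assumes M: "M \<in> carrier_mat n n" and c: "0 \<le> c"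
    and entries: "\<And>r s. r < n \<Longrightarrow> s < n \<Longrightarrow> M $$ (r, s) = (if r = s then d r else 0)"
    and d: "\<And>r. r < n \<Longrightarrow> cmod (d r) \<le> c"
  shows "op_norm M \<le> c"
proof -
  define len where "len v = L2_set (\<lambda>i. cmod (vec_index v i)) {..<dim_vec v}" for v :: "complex vec"
  have le: "len (M *\<^sub>v v) \<le> c" if v: "v \<in> carrier_vec n" "len v \<le> 1" for v
  proof -
    have dim: "dim_vec v = n" "dim_row M = n" using v M by auto
    have "vec_index (M *\<^sub>v v) r = d r * vec_index v r" if r: "r < n" for r
    proof -
      have "vec_index (M *\<^sub>v v) r = (\<Sum>s<n. M $$ (r, s) * vec_index v s)"
        using r M v by (auto simp: scalar_prod_def lessThan_atLeast0 intro!: sum.cong)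
      also have "\<dots> = (\<Sum>s<n. if s = r then d r * vec_index v r else 0)"
        using r by (intro sum.cong) (auto simp: entries)
      finally show ?thesis using r by simp
    qed
    then have "len (M *\<^sub>v v) = L2_set (\<lambda>i. cmod (d i * vec_index v i)) {..<n}"
      unfolding len_def using dim by (intro L2_set_cong) auto
    also have "\<dots> \<le> L2_set (\<lambda>i. c * cmod (vec_index v i)) {..<n}"
      using d by (intro L2_set_mono) (auto simp: norm_mult mult_right_mono)
    also have "\<dots> = c * len v" using c by (simp add: len_def dim L2_set_right_distrib)
    also have "\<dots> \<le> c" using v(2) c by (simp add: mult_left_le)
    finally show ?thesis .
  qed
  have "op_norm M = Sup {len (M *\<^sub>v v) | v. v \<in> carrier_vec (dim_col M) \<and> len v \<le> 1}"
    by (simp add: op_norm_def len_def Let_def)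
  also have "\<dots> \<le> c"
  proof (rule cSup_least)
    have "len (0\<^sub>v n) \<le> 1" by (simp add: len_def L2_set_def)
    then show "{len (M *\<^sub>v v) | v. v \<in> carrier_vec (dim_col M) \<and> len v \<le> 1} \<noteq> {}"
      using M by (auto intro!: exI[of _ "0\<^sub>v n"])
  qed (use le M in auto)
  finally show ?thesis .
qed

text \<open>The diagonal of \<open>M* M\<close> lists the squared norms of the columns. Through it,
  positivity of an element reaches its diagonal entries.\<close>

lemma mat_adjoint_mult_diag:
  fixes M :: "complex mat"
  assumes "M \<in> carrier_mat n n" "r < n"
  shows "(mat_adjoint M * M) $$ (r, r) = of_real (\<Sum>k<n. (cmod (M $$ (k, r)))\<^sup>2)"
proof -
  have dims: "dim_row M = n" "dim_col M = n" using assms by auto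
  have "(mat_adjoint M * M) $$ (r, r) = (\<Sum>k<n. cnj (M $$ (k, r)) * M $$ (k, r))"
    using assms(2)
    by (auto simp: mat_adjoint_def scalar_prod_def dims lessThan_atLeast0 mat_of_rows_index intro!: sum.cong)
  also have "\<dots> = of_real (\<Sum>k<n. (cmod (M $$ (k, r)))\<^sup>2)"
    by (simp add: complex_norm_square[symmetric] mult.commute[of "cnj _"] flip: of_real_power)
  finally show ?thesis .
qed

section \<open>Recursive subhomogeneous algebras of diagonal type\<close>

lemma rsh_alg_simps [simp]:
  "carrier (rsh_alg X X0 n \<eta> i) = rsh_carrier X X0 n \<eta> i"
  "mult (rsh_alg X X0 n \<eta> i) = (\<lambda>f g. \<lambda>j\<in>{..i}. f j \<otimes>\<^bsub>matrix_alg (X j) (n j)\<^esub> g j)"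
  "one (rsh_alg X X0 n \<eta> i) = (\<lambda>j\<in>{..i}. \<one>\<^bsub>matrix_alg (X j) (n j)\<^esub>)"
  by (simp_all add: rsh_alg_def Let_def)

lemma matrix_alg_simps [simp]:
  "carrier (matrix_alg X n) = {f \<in> topspace X \<rightarrow>\<^sub>E carrier_mat n n.
     \<forall>r<n. \<forall>s<n. continuous_map X euclidean (\<lambda>x. f x $$ (r, s))}"
  "mult (matrix_alg X n) = (\<lambda>f g. \<lambda>x\<in>topspace X. f x * g x)"
  "one (matrix_alg X n) = (\<lambda>x\<in>topspace X. 1\<^sub>m n)"
  by (simp_all add: matrix_alg_def)

lemma one_matrix_alg: "(\<lambda>x\<in>topspace Y. 1\<^sub>m m) \<in> carrier (matrix_alg Y m)"
proof -
  have "continuous_map Y euclidean (\<lambda>x. (\<lambda>x\<in>topspace Y. 1\<^sub>m m :: complex mat) x $$ (r, s))" for r s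
    by (rule continuous_map_eq[where f = "\<lambda>x. 1\<^sub>m m $$ (r, s)"]) auto
  then show ?thesis by (simp add: PiE_iff)
qed

locale diagonal_rsh =
  fixes K :: nat
    and X :: "nat \<Rightarrow> 'a topology"
    and X0 :: "nat \<Rightarrow> 'a set"
    and n :: "nat \<Rightarrow> nat"
    and \<eta> :: "nat \<Rightarrow> (nat \<Rightarrow> 'a \<Rightarrow> complex mat) \<Rightarrow> 'a \<Rightarrow> complex mat"
  assumes decomposition: "rsh_decomposition K X X0 n \<eta>"
    and diagonal: "\<forall>i<K. diagonal_type X i (rsh_alg X X0 n \<eta> i)
      (subtopology (X (Suc i)) (X0 (Suc i))) (\<eta> i)"
begin

abbreviation "A \<equiv> rsh_carrier X X0 n \<eta>"

lemma X0_subset: "i \<le> K \<Longrightarrow> X0 i \<subseteq> topspace (X i)"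
  using decomposition closedin_subset unfolding rsh_decomposition_def by blast

lemma topspace_X0: "i \<le> K \<Longrightarrow> topspace (subtopology (X i) (X0 i)) = X0 i"
  using X0_subset by auto

lemma eta_hom:
  assumes "i < K"
  shows "\<eta> i \<in> Ring.ring_hom (rsh_alg X X0 n \<eta> i)
    (matrix_alg (subtopology (X (Suc i)) (X0 (Suc i))) (n (Suc i)))"
  using decomposition assms unfolding rsh_decomposition_def unital_star_hom_def by blast

lemma eta_carrier:
  assumes "i < K" "f \<in> A i"
  shows "\<eta> i f \<in> carrier (matrix_alg (subtopology (X (Suc i)) (X0 (Suc i))) (n (Suc i)))"
  using ring_hom_closed[OF eta_hom[OF assms(1)], of f] assms(2) by simp

lemma rsh_carrier_PiE: "f \<in> A i \<Longrightarrow> f \<in> (\<Pi>\<^sub>E j\<in>{..i}. carrier (matrix_alg (X j) (n j)))"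
  by (cases i) auto

text \<open>At one point a map of diagonal type is evaluation along a finite list of pairs (stage,
  point), found in the part of the partition containing \<open>y\<close>. The same list serves all
  \<open>f\<close>.\<close>

lemma eta_diag_block:
  assumes "i < K" "y \<in> X0 (Suc i)"
  shows "\<exists>zs. (\<forall>z\<in>set zs. fst z \<le> i \<and> snd z \<in> topspace (X (fst z))) \<and>
    (\<forall>f\<in>A i. \<eta> i f y = diag_block_mat (map (\<lambda>z. f (fst z) (snd z)) zs))"
proof -
  let ?Y = "subtopology (X (Suc i)) (X0 (Suc i))"
  have Y: "topspace ?Y = X0 (Suc i)" using topspace_X0 assms(1) by simp
  obtain \<P> where part: "partition_on (topspace ?Y) \<P>"
    and \<P>: "\<forall>P\<in>\<P>. \<exists>(s::nat) (t :: nat \<Rightarrow> nat) (l :: nat \<Rightarrow> 'a \<Rightarrow> 'a).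
      (\<forall>j<s. t j \<le> i \<and> continuous_map (subtopology ?Y P) (X (t j)) (l j)) \<and>
      (\<forall>f\<in>carrier (rsh_alg X X0 n \<eta> i). \<forall>y\<in>P.
         \<eta> i f y = diag_block_mat (map (\<lambda>j. f (t j) (l j y)) [0..<s]))"
    using diagonal assms(1) unfolding diagonal_type_def by blast
  obtain P where P: "P \<in> \<P>" "y \<in> P" using part assms(2) Y unfolding partition_on_def by blast
  have yP: "y \<in> topspace (subtopology ?Y P)" using P(2) assms(2) Y by simp
  from bspec[OF \<P> P(1)] show ?thesis
  proof (elim exE conjE)
    fix s :: nat and t :: "nat \<Rightarrow> nat" and l :: "nat \<Rightarrow> 'a \<Rightarrow> 'a"
    assume l: "\<forall>j<s. t j \<le> i \<and> continuous_map (subtopology ?Y P) (X (t j)) (l j)"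
      and eq: "\<forall>f\<in>carrier (rsh_alg X X0 n \<eta> i). \<forall>y\<in>P.
         \<eta> i f y = diag_block_mat (map (\<lambda>j. f (t j) (l j y)) [0..<s])"
    have "l j y \<in> topspace (X (t j))" if "j < s" for j
      using l that yP continuous_map_image_subset_topspace by fastforce
    then show ?thesis
      using l eq P(2) by (intro exI[of _ "map (\<lambda>j. (t j, l j y)) [0..<s]"]) (auto simp: o_def)
  qed
qed

definition blocks :: "nat \<Rightarrow> 'a \<Rightarrow> (nat \<times> 'a) list" where
  "blocks i y = (SOME zs. (\<forall>z\<in>set zs. fst z \<le> i \<and> snd z \<in> topspace (X (fst z))) \<and>
    (\<forall>f\<in>A i. \<eta> i f y = diag_block_mat (map (\<lambda>z. f (fst z) (snd z)) zs)))"

lemma blocks: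
  assumes "i < K" "y \<in> X0 (Suc i)"
  shows "z \<in> set (blocks i y) \<Longrightarrow> fst z \<le> i \<and> snd z \<in> topspace (X (fst z))"
    and "f \<in> A i \<Longrightarrow> \<eta> i f y = diag_block_mat (map (\<lambda>z. f (fst z) (snd z)) (blocks i y))"
proof -
  note * = someI_ex[OF eta_diag_block[OF assms], folded blocks_def]
  show "z \<in> set (blocks i y) \<Longrightarrow> fst z \<le> i \<and> snd z \<in> topspace (X (fst z))"
    by (rule bspec[OF conjunct1[OF *]])
  show "f \<in> A i \<Longrightarrow> \<eta> i f y = diag_block_mat (map (\<lambda>z. f (fst z) (snd z)) (blocks i y))"
    by (rule bspec[OF conjunct2[OF *]])
qed

text \<open>Unitality of the attaching maps is the gluing condition for the constant unit.\<close>

lemma one_carrier: "i \<le> K \<Longrightarrow> (\<lambda>j\<in>{..i}. \<lambda>x\<in>topspace (X j). 1\<^sub>m (n j)) \<in> A i"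
proof (induction i)
  case 0
  show ?case unfolding rsh_carrier.simps restrict_PiE_iff using one_matrix_alg by blast
next
  case (Suc i)
  let ?one = "\<lambda>i. \<lambda>j\<in>{..i}. \<lambda>x\<in>topspace (X j). 1\<^sub>m (n j) :: complex mat"
  have PiE: "?one (Suc i) \<in> (\<Pi>\<^sub>E j\<in>{..Suc i}. carrier (matrix_alg (X j) (n j)))"
    unfolding restrict_PiE_iff using one_matrix_alg by blast
  have restr: "restrict (?one (Suc i)) {..i} = ?one i" by (auto simp: restrict_def)
  have "\<eta> i (?one i) = (\<lambda>x\<in>topspace (subtopology (X (Suc i)) (X0 (Suc i))). 1\<^sub>m (n (Suc i)))"
    using ring_hom_one[OF eta_hom[of i]] Suc.prems by simp
  also have "\<dots> = restrict (?one (Suc i) (Suc i)) (X0 (Suc i))"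
    unfolding topspace_X0[OF Suc.prems] using X0_subset[OF Suc.prems] by (intro ext) auto
  finally have "\<eta> i (?one i) = restrict (?one (Suc i) (Suc i)) (X0 (Suc i))" .
  moreover have "?one i \<in> A i" by (rule Suc.IH) (use Suc.prems in simp)
  ultimately show ?case unfolding rsh_carrier.simps mem_Collect_eq restr using PiE by blast
qed

text \<open>Evaluating \<open>\<eta> i\<close> on the unit gives a block sum of identity matrices,
  whose size must be that of the target.\<close>

lemma sum_blocks:
  assumes "i < K" "y \<in> X0 (Suc i)"
  shows "sum_list (map (\<lambda>z. n (fst z)) (blocks i y)) = n (Suc i)"
proof -
  let ?one = "\<lambda>j\<in>{..i}. \<lambda>x\<in>topspace (X j). 1\<^sub>m (n j) :: complex mat"
  have one: "?one \<in> A i" using one_carrier assms(1) by simp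
  have "\<eta> i ?one y = diag_block_mat (map (\<lambda>z. ?one (fst z) (snd z)) (blocks i y))"
    by (rule blocks(2)[OF assms one])
  also have "map (\<lambda>z. ?one (fst z) (snd z)) (blocks i y) = map (\<lambda>z. 1\<^sub>m (n (fst z))) (blocks i y)"
    using blocks(1)[OF assms] by (intro map_cong) auto
  also have "diag_block_mat \<dots> = 1\<^sub>m (sum_list (map (\<lambda>z. n (fst z)) (blocks i y)))"
    by (rule diag_block_mat_one[where d = "\<lambda>z. n (fst z)"])
  finally have *: "\<eta> i ?one y = 1\<^sub>m (sum_list (map (\<lambda>z. n (fst z)) (blocks i y)))" .
  have "\<eta> i ?one y \<in> carrier_mat (n (Suc i)) (n (Suc i))"
    using eta_carrier[OF assms(1) one] topspace_X0[of "Suc i"] assms by (auto simp: PiE_iff)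
  from carrier_matD(1)[OF this] show ?thesis unfolding * by simp
qed

text \<open>Membership in a stage, stated pointwise and without extensionality: the gluing conditions
  become block decompositions over the points of the sets \<open>X0\<close>.\<close>

definition element :: "nat \<Rightarrow> (nat \<Rightarrow> 'a \<Rightarrow> complex mat) \<Rightarrow> bool" where
  "element k F \<longleftrightarrow>
     (\<forall>j\<le>k. \<forall>x\<in>topspace (X j). F j x \<in> carrier_mat (n j) (n j)) \<and>
     (\<forall>j\<le>k. \<forall>r<n j. \<forall>s<n j. continuous_map (X j) euclidean (\<lambda>x. F j x $$ (r, s))) \<and>
     (\<forall>i<k. \<forall>y\<in>X0 (Suc i). F (Suc i) y = diag_block_mat (map (\<lambda>z. F (fst z) (snd z)) (blocks i y)))"

lemma elementD:
  assumes "element k F"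
  shows "j \<le> k \<Longrightarrow> x \<in> topspace (X j) \<Longrightarrow> F j x \<in> carrier_mat (n j) (n j)"
    and "j \<le> k \<Longrightarrow> r < n j \<Longrightarrow> s < n j \<Longrightarrow> continuous_map (X j) euclidean (\<lambda>x. F j x $$ (r, s))"
    and "i < k \<Longrightarrow> y \<in> X0 (Suc i) \<Longrightarrow> F (Suc i) y = diag_block_mat (map (\<lambda>z. F (fst z) (snd z)) (blocks i y))"
  using assms unfolding element_def by blast+

lemma element_block:
  assumes "element k F" "i < k" "k \<le> K" "y \<in> X0 (Suc i)" "z \<in> set (blocks i y)"
  shows "F (fst z) (snd z) \<in> carrier_mat (n (fst z)) (n (fst z))"
  using blocks(1)[of i y z] elementD(1)[OF assms(1), of "fst z" "snd z"] assms by simp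

lemma carrier_imp_element: "f \<in> A k \<Longrightarrow> k \<le> K \<Longrightarrow> element k f"
proof (induction k arbitrary: f)
  case 0
  then show ?case unfolding element_def by (auto simp: PiE_iff)
next
  case (Suc k)
  have f: "f \<in> (\<Pi>\<^sub>E j\<in>{..Suc k}. carrier (matrix_alg (X j) (n j)))"
    using Suc.prems(1) by (rule rsh_carrier_PiE)
  have g: "restrict f {..k} \<in> A k" and eq: "\<eta> k (restrict f {..k}) = restrict (f (Suc k)) (X0 (Suc k))"
    using Suc.prems by auto
  have el: "element k (restrict f {..k})" using Suc g by simp
  have glue: "f (Suc i) y = diag_block_mat (map (\<lambda>z. f (fst z) (snd z)) (blocks i y))"
    if i: "i < Suc k" and y: "y \<in> X0 (Suc i)" for i y
  proof -
    \<comment> \<open>The blocks over \<open>X0 (Suc i)\<close> refer only to stages up to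
      \<open>i\<close>, so truncating at \<open>k\<close> does not affect them.\<close>
    have *: "map (\<lambda>z. restrict f {..k} (fst z) (snd z)) (blocks i y) = map (\<lambda>z. f (fst z) (snd z)) (blocks i y)"
      using blocks(1)[of i y] i y Suc.prems(2) by (intro map_cong) force+
    show ?thesis
    proof (cases "i = k")
      case True
      have "f (Suc k) y = \<eta> k (restrict f {..k}) y" using eq y True by simp
      also have "\<dots> = diag_block_mat (map (\<lambda>z. restrict f {..k} (fst z) (snd z)) (blocks k y))"
        using blocks(2)[of k y] g y True Suc.prems(2) by simp
      finally show ?thesis unfolding True *[unfolded True] .
    next
      case False
      then have "f (Suc i) y = diag_block_mat (map (\<lambda>z. restrict f {..k} (fst z) (snd z)) (blocks i y))"
        using elementD(3)[OF el, of i y] i y by simp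
      then show ?thesis unfolding * .
    qed
  qed
  show ?case unfolding element_def using f glue by (auto simp: PiE_iff)
qed

text \<open>The extensional representative of \<open>F\<close>, as the carriers require.\<close>

abbreviation family :: "nat \<Rightarrow> (nat \<Rightarrow> 'a \<Rightarrow> complex mat) \<Rightarrow> nat \<Rightarrow> 'a \<Rightarrow> complex mat" where
  "family k F \<equiv> (\<lambda>j\<in>{..k}. restrict (F j) (topspace (X j)))"

lemma element_imp_carrier: "element k F \<Longrightarrow> k \<le> K \<Longrightarrow> family k F \<in> A k"
proof (induction k)
  case 0
  have "continuous_map (X 0) euclidean (\<lambda>x. restrict (F 0) (topspace (X 0)) x $$ (r, s))"
    if "r < n 0" "s < n 0" for r s
    using elementD(2)[OF 0(1) _ that] by (rule continuous_map_eq) auto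
  then show ?case using elementD(1)[OF 0(1)] by (auto simp: PiE_iff extensional_def)
next
  case (Suc k)
  have el: "element k F" using Suc.prems(1) unfolding element_def by auto
  have IH: "family k F \<in> A k" by (rule Suc.IH[OF el]) (use Suc.prems in simp)
  have restr: "restrict (family (Suc k) F) {..k} = family k F" by (auto simp: restrict_def)
  have "continuous_map (X j) euclidean (\<lambda>x. restrict (F j) (topspace (X j)) x $$ (r, s))"
    if "j \<le> Suc k" "r < n j" "s < n j" for j r s
    using elementD(2)[OF Suc.prems(1) that] by (rule continuous_map_eq) auto
  then have PiE: "family (Suc k) F \<in> (\<Pi>\<^sub>E j\<in>{..Suc k}. carrier (matrix_alg (X j) (n j)))"
    using elementD(1)[OF Suc.prems(1)] by (auto simp: PiE_iff extensional_def)
  have "\<eta> k (family k F) = restrict (family (Suc k) F (Suc k)) (X0 (Suc k))"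
  proof (rule extensionalityI[where A = "X0 (Suc k)"])
    show "\<eta> k (family k F) \<in> extensional (X0 (Suc k))"
      using eta_carrier[OF _ IH] topspace_X0[of "Suc k"] Suc.prems(2) by (auto simp: PiE_iff)
    fix y assume y: "y \<in> X0 (Suc k)"
    have "\<eta> k (family k F) y = diag_block_mat (map (\<lambda>z. family k F (fst z) (snd z)) (blocks k y))"
      using blocks(2)[OF _ y IH] Suc.prems(2) by simp
    also have "map (\<lambda>z. family k F (fst z) (snd z)) (blocks k y) = map (\<lambda>z. F (fst z) (snd z)) (blocks k y)"
      using blocks(1)[of k y] y Suc.prems(2) by (intro map_cong) auto
    also have "diag_block_mat \<dots> = F (Suc k) y" using elementD(3)[OF Suc.prems(1), of k y] y by simp
    finally have *: "\<eta> k (family k F) y = F (Suc k) y" .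
    show "\<eta> k (family k F) y = restrict (family (Suc k) F (Suc k)) (X0 (Suc k)) y"
      unfolding * using y X0_subset[of "Suc k"] Suc.prems(2) by auto
  qed (auto simp: extensional_def)
  then show ?case unfolding rsh_carrier.simps mem_Collect_eq restr using PiE IH by blast
qed

section \<open>Pointwise operations preserving the gluing conditions\<close>

lemma element_map_mat:
  assumes "element k F" "k \<le> K" "\<phi> 0 = 0" "continuous_on UNIV \<phi>"
  shows "element k (\<lambda>j x. map_mat \<phi> (F j x))"
  unfolding element_def
proof (intro conjI allI ballI impI)
  show "map_mat \<phi> (F j x) \<in> carrier_mat (n j) (n j)" if "j \<le> k" "x \<in> topspace (X j)" for j x
    using elementD(1)[OF assms(1) that] by simp
  show "continuous_map (X j) euclidean (\<lambda>x. map_mat \<phi> (F j x) $$ (r, s))"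
    if "j \<le> k" "r < n j" "s < n j" for j r s
    using continuous_map_compose_UNIV[OF elementD(2)[OF assms(1) that] assms(4)]
    by (rule continuous_map_eq) (use elementD(1)[OF assms(1)] that in force)
  show "map_mat \<phi> (F (Suc i) y) = diag_block_mat (map (\<lambda>z. map_mat \<phi> (F (fst z) (snd z))) (blocks i y))"
    if "i < k" "y \<in> X0 (Suc i)" for i y
    using elementD(3)[OF assms(1) that] diag_block_mat_map_mat[where \<phi> = \<phi>, OF assms(3)]
    by simp
qed

lemma element_mult:
  assumes "element k F" "element k G" "k \<le> K"
  shows "element k (\<lambda>j x. F j x * G j x)"
  unfolding element_def
proof (intro conjI allI ballI impI)
  show "F j x * G j x \<in> carrier_mat (n j) (n j)" if "j \<le> k" "x \<in> topspace (X j)" for j x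
    using elementD(1)[OF assms(1) that] elementD(1)[OF assms(2) that] by simp
  show "continuous_map (X j) euclidean (\<lambda>x. (F j x * G j x) $$ (r, s))"
    if "j \<le> k" "r < n j" "s < n j" for j r s
  proof -
    have "continuous_map (X j) euclidean (\<lambda>x. \<Sum>l<n j. F j x $$ (r, l) * G j x $$ (l, s))"
      using elementD(2)[OF assms(1)] elementD(2)[OF assms(2)] that
      by (intro continuous_map_sum continuous_map_times_complex) auto
    then show ?thesis
    proof (rule continuous_map_eq)
      fix x assume "x \<in> topspace (X j)"
      then have "F j x \<in> carrier_mat (n j) (n j)" "G j x \<in> carrier_mat (n j) (n j)"
        using elementD(1)[OF assms(1)] elementD(1)[OF assms(2)] that by auto
      then show "(\<Sum>l<n j. F j x $$ (r, l) * G j x $$ (l, s)) = (F j x * G j x) $$ (r, s)"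
        using that by (auto simp: scalar_prod_def lessThan_atLeast0 intro!: sum.cong)
    qed
  qed
  show "F (Suc i) y * G (Suc i) y = diag_block_mat (map (\<lambda>z. F (fst z) (snd z) * G (fst z) (snd z)) (blocks i y))"
    if "i < k" "y \<in> X0 (Suc i)" for i y
    using elementD(3)[OF assms(1) that] elementD(3)[OF assms(2) that]
      diag_block_mat_mult[of "blocks i y" "\<lambda>z. F (fst z) (snd z)" "\<lambda>z. n (fst z)" "\<lambda>z. G (fst z) (snd z)",
        OF element_block[OF assms(1) that(1) assms(3) that(2)]
           element_block[OF assms(2) that(1) assms(3) that(2)]]
    by simp
qed

lemma element_add:
  assumes "element k F" "element k G" "k \<le> K"
  shows "element k (\<lambda>j x. F j x + G j x)"
  unfolding element_def
proof (intro conjI allI ballI impI)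
  show "F j x + G j x \<in> carrier_mat (n j) (n j)" if "j \<le> k" "x \<in> topspace (X j)" for j x
    using elementD(1)[OF assms(1) that] elementD(1)[OF assms(2) that] by simp
  show "continuous_map (X j) euclidean (\<lambda>x. (F j x + G j x) $$ (r, s))"
    if "j \<le> k" "r < n j" "s < n j" for j r s
  proof -
    have "continuous_map (X j) euclidean (\<lambda>x. F j x $$ (r, s) + G j x $$ (r, s))"
      using elementD(2)[OF assms(1)] elementD(2)[OF assms(2)] that by (intro continuous_map_add) auto
    then show ?thesis
    proof (rule continuous_map_eq)
      fix x assume "x \<in> topspace (X j)"
      then have "F j x \<in> carrier_mat (n j) (n j)" "G j x \<in> carrier_mat (n j) (n j)"
        using elementD(1)[OF assms(1)] elementD(1)[OF assms(2)] that by auto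
      then show "F j x $$ (r, s) + G j x $$ (r, s) = (F j x + G j x) $$ (r, s)"
        using that by auto
    qed
  qed
  show "F (Suc i) y + G (Suc i) y = diag_block_mat (map (\<lambda>z. F (fst z) (snd z) + G (fst z) (snd z)) (blocks i y))"
    if "i < k" "y \<in> X0 (Suc i)" for i y
    using elementD(3)[OF assms(1) that] elementD(3)[OF assms(2) that]
      diag_block_mat_add[of "blocks i y" "\<lambda>z. F (fst z) (snd z)" "\<lambda>z. n (fst z)" "\<lambda>z. G (fst z) (snd z)",
        OF element_block[OF assms(1) that(1) assms(3) that(2)]
           element_block[OF assms(2) that(1) assms(3) that(2)]]
    by simp
qed

lemma element_one:
  assumes "k \<le> K"
  shows "element k (\<lambda>j x. 1\<^sub>m (n j))"
  unfolding element_def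
proof (intro conjI allI ballI impI)
  show "1\<^sub>m (n (Suc i)) = diag_block_mat (map (\<lambda>z. 1\<^sub>m (n (fst z)) :: complex mat) (blocks i y))"
    if "i < k" "y \<in> X0 (Suc i)" for i y
    unfolding diag_block_mat_one[where d = "\<lambda>z. n (fst z)"]
    using sum_blocks[OF _ that(2)] that(1) assms by simp
qed auto

text \<open>Pointwise invertibility suffices, because inversion is continuous in the entries and
  commutes with block sums.\<close>

lemma element_inv_mat:
  assumes "element k F" "k \<le> K"
    and det: "\<And>j x. j \<le> k \<Longrightarrow> x \<in> topspace (X j) \<Longrightarrow> Determinant.det (F j x) \<noteq> 0"
  shows "element k (\<lambda>j x. inv_mat (F j x))"
  unfolding element_def
proof (intro conjI allI ballI impI)
  show "inv_mat (F j x) \<in> carrier_mat (n j) (n j)" if "j \<le> k" "x \<in> topspace (X j)" for j x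
    using inv_mat(1)[OF elementD(1)[OF assms(1) that] det[OF that]] .
  show "continuous_map (X j) euclidean (\<lambda>x. inv_mat (F j x) $$ (r, s))"
    if j: "j \<le> k" and rs: "r < n j" "s < n j" for j r s
    by (rule continuous_map_inv_mat[where n = "n j"])
      (use elementD(1,2)[OF assms(1)] det j rs in auto)
  show "inv_mat (F (Suc i) y) = diag_block_mat (map (\<lambda>z. inv_mat (F (fst z) (snd z))) (blocks i y))"
    if i: "i < k" and y: "y \<in> X0 (Suc i)" for i y
  proof -
    have "i < K" "Suc i \<le> k" "y \<in> topspace (X (Suc i))"
      using i y assms(2) X0_subset[of "Suc i"] by auto
    show ?thesis
      unfolding elementD(3)[OF assms(1) i y]
    proof (rule diag_block_mat_inverse)
      fix z assume z: "z \<in> set (blocks i y)"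
      show "F (fst z) (snd z) \<in> carrier_mat (n (fst z)) (n (fst z))"
        by (rule element_block[OF assms(1) i assms(2) y z])
      show "Determinant.det (F (fst z) (snd z)) \<noteq> 0"
        using blocks(1)[OF \<open>i < K\<close> y z] i by (intro det) auto
    next
      show "Determinant.det (diag_block_mat (map (\<lambda>z. F (fst z) (snd z)) (blocks i y))) \<noteq> 0"
        using det[OF \<open>Suc i \<le> k\<close> \<open>y \<in> topspace (X (Suc i))\<close>] elementD(3)[OF assms(1) i y] by simp
    qed
  qed
qed

text \<open>Induction over the stages. On \<open>X0 (Suc k)\<close> gluing forces the value to be
  the block sum of earlier chain matrices, which is again a dominated chain matrix; the extension
  lemma then carries it to the whole space, using the rank inequality off
  \<open>X0 (Suc k)\<close>.\<close>

lemma element_chain_mat: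
  assumes ab: "element K a" "element K b" and \<epsilon>: "0 < \<epsilon>"
    and rank: "\<And>i x. i \<le> K \<Longrightarrow> x \<in> topspace (X i) - X0 i \<Longrightarrow>
      card {r. r < n i \<and> a i x $$ (r, r) \<noteq> 0} \<le> card {q. q < n i \<and> b i x $$ (q, q) \<noteq> 0}"
  shows "k \<le> K \<Longrightarrow> \<exists>W. element k W \<and> (\<forall>j\<le>k. \<forall>x\<in>topspace (X j).
    is_chain_mat (n j) (W j x) \<and> block_dominated \<epsilon> (n j) (a j x) (b j x) (W j x))"
proof (induction k)
  \<comment> \<open>The extension step for one space, shared by the base case, where the attaching
    set is empty, and the induction step.\<close>
  have stage: "\<exists>W. (\<forall>x\<in>topspace (X i). is_chain_mat (n i) (W x) \<and> block_dominated \<epsilon> (n i) (a i x) (b i x) (W x))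
      \<and> (\<forall>y\<in>X0 i. W y = W\<^sub>0 y)
      \<and> (\<forall>r<n i. \<forall>s<n i. continuous_map (X i) euclidean (\<lambda>x. W x $$ (r, s)))"
    if i: "i \<le> K"
      and W\<^sub>0: "\<And>y. y \<in> X0 i \<Longrightarrow> is_chain_mat (n i) (W\<^sub>0 y)"
        "\<And>y. y \<in> X0 i \<Longrightarrow> block_dominated \<epsilon> (n i) (a i y) (b i y) (W\<^sub>0 y)"
        "\<And>r s. r < n i \<Longrightarrow> s < n i \<Longrightarrow>
          continuous_map (subtopology (X i) (X0 i)) euclidean (\<lambda>y. W\<^sub>0 y $$ (r, s))"
    for i W\<^sub>0
  proof -
    have X: "compact_space (X i)" "Hausdorff_space (X i)" "closedin (X i) (X0 i)"
      using decomposition i unfolding rsh_decomposition_def by auto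
    have rank': "card {r. r < n i \<and> \<epsilon> \<le> Re (a i x $$ (r, r))} \<le> card {q. q < n i \<and> b i x $$ (q, q) \<noteq> 0}"
      if "x \<in> topspace (X i) - X0 i" for x
    proof -
      have "card {r. r < n i \<and> \<epsilon> \<le> Re (a i x $$ (r, r))} \<le> card {r. r < n i \<and> a i x $$ (r, r) \<noteq> 0}"
        using \<epsilon> by (intro card_mono) auto
      then show ?thesis using rank[OF i that] by linarith
    qed
    show ?thesis
    proof (rule chain_mat_extension[OF X, of "n i" "a i" "b i" W\<^sub>0 \<epsilon>])
      show "continuous_map (X i) euclidean (\<lambda>x. a i x $$ (r, r))"
        "continuous_map (X i) euclidean (\<lambda>x. b i x $$ (r, r))" if "r < n i" for r
        using elementD(2)[OF ab(1) i that that] elementD(2)[OF ab(2) i that that] by blast+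
    next
      fix W
      assume "\<And>x. x \<in> topspace (X i) \<Longrightarrow> is_chain_mat (n i) (W x)"
        "\<And>x. x \<in> topspace (X i) \<Longrightarrow> block_dominated \<epsilon> (n i) (a i x) (b i x) (W x)"
        "\<And>y. y \<in> X0 i \<Longrightarrow> W y = W\<^sub>0 y"
        "\<And>r s. r < n i \<Longrightarrow> s < n i \<Longrightarrow> continuous_map (X i) euclidean (\<lambda>x. W x $$ (r, s))"
      then show ?thesis by (intro exI[of _ W]) auto
    qed (use W\<^sub>0 rank' in auto)
  qed
  {
    case 0
    have "X0 0 = {}" using decomposition unfolding rsh_decomposition_def by blast
    \<comment> \<open>Nothing is prescribed on the empty set \<open>X0 0\<close>; the 0 by 0
      identity is a dummy value.\<close>
    then have "continuous_map (subtopology (X 0) (X0 0)) euclidean (\<lambda>y. 1\<^sub>m 0 $$ (r, s) :: complex)" for r s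
      by simp
    with \<open>X0 0 = {}\<close> obtain W where "\<forall>x\<in>topspace (X 0). is_chain_mat (n 0) (W x) \<and> block_dominated \<epsilon> (n 0) (a 0 x) (b 0 x) (W x)"
      "\<forall>r<n 0. \<forall>s<n 0. continuous_map (X 0) euclidean (\<lambda>x. W x $$ (r, s))"
      using stage[of 0 "\<lambda>y. 1\<^sub>m 0"] by auto
    then show ?case
      using is_chain_mat_carrier by (intro exI[of _ "\<lambda>_. W"]) (auto simp: element_def)
  next
    case (Suc k)
    then obtain W where W: "element k W" and
      W_dom: "\<And>j x. j \<le> k \<Longrightarrow> x \<in> topspace (X j) \<Longrightarrow> is_chain_mat (n j) (W j x)"
        "\<And>j x. j \<le> k \<Longrightarrow> x \<in> topspace (X j) \<Longrightarrow> block_dominated \<epsilon> (n j) (a j x) (b j x) (W j x)"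
      by auto
    have kK: "k < K" "k \<le> K" using Suc.prems by auto
    define W\<^sub>0 where "W\<^sub>0 y = diag_block_mat (map (\<lambda>z. W (fst z) (snd z)) (blocks k y))" for y
    have chain: "is_chain_mat (n (Suc k)) (W\<^sub>0 y)" if y: "y \<in> X0 (Suc k)" for y
      using is_chain_mat_diag_block[of "blocks k y" "\<lambda>z. n (fst z)" "\<lambda>z. W (fst z) (snd z)"]
        W_dom(1) blocks(1)[OF kK(1) y] sum_blocks[OF kK(1) y] by (simp add: W\<^sub>0_def)
    have dom: "block_dominated \<epsilon> (n (Suc k)) (a (Suc k) y) (b (Suc k) y) (W\<^sub>0 y)"
      if y: "y \<in> X0 (Suc k)" for y
      unfolding elementD(3)[OF ab(1) kK(1) y] elementD(3)[OF ab(2) kK(1) y] W\<^sub>0_def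
        sum_blocks[OF kK(1) y, symmetric]
    proof (rule block_dominated_diag_block)
      fix z assume z: "z \<in> set (blocks k y)"
      show "a (fst z) (snd z) \<in> carrier_mat (n (fst z)) (n (fst z))"
        by (rule element_block[OF ab(1) kK(1) order_refl y z])
      show "b (fst z) (snd z) \<in> carrier_mat (n (fst z)) (n (fst z))"
        by (rule element_block[OF ab(2) kK(1) order_refl y z])
      show "W (fst z) (snd z) \<in> carrier_mat (n (fst z)) (n (fst z))"
        "block_dominated \<epsilon> (n (fst z)) (a (fst z) (snd z)) (b (fst z) (snd z)) (W (fst z) (snd z))"
        using W_dom blocks(1)[OF kK(1) y z] is_chain_mat_carrier by auto
    qed
    have cont: "continuous_map (subtopology (X (Suc k)) (X0 (Suc k))) euclidean (\<lambda>y. W\<^sub>0 y $$ (r, s))"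
      if rs: "r < n (Suc k)" "s < n (Suc k)" for r s
    proof -
      have car: "family k W \<in> A k" by (rule element_imp_carrier[OF W kK(2)])
      have eq: "\<eta> k (family k W) y = W\<^sub>0 y" if y: "y \<in> X0 (Suc k)" for y
        unfolding blocks(2)[OF kK(1) y car] W\<^sub>0_def
        using blocks(1)[OF kK(1) y] by (intro arg_cong[where f = diag_block_mat] map_cong) auto
      \<comment> \<open>The list of blocks may jump between parts of the partition, so continuity is
        not visible from the block sum. It holds because \<open>\<eta> k\<close> sends the family
        built so far to a continuous matrix function.\<close>
      have "continuous_map (subtopology (X (Suc k)) (X0 (Suc k))) euclidean (\<lambda>y. \<eta> k (family k W) y $$ (r, s))"
        using eta_carrier[OF kK(1) car] rs unfolding matrix_alg_simps by blast
      then show ?thesis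
        by (rule continuous_map_eq) (use eq in auto)
    qed
    obtain W\<^sub>1 where W\<^sub>1: "\<forall>x\<in>topspace (X (Suc k)). is_chain_mat (n (Suc k)) (W\<^sub>1 x)
        \<and> block_dominated \<epsilon> (n (Suc k)) (a (Suc k) x) (b (Suc k) x) (W\<^sub>1 x)"
      "\<forall>y\<in>X0 (Suc k). W\<^sub>1 y = W\<^sub>0 y"
      "\<forall>r<n (Suc k). \<forall>s<n (Suc k). continuous_map (X (Suc k)) euclidean (\<lambda>x. W\<^sub>1 x $$ (r, s))"
      using stage[OF Suc.prems chain dom cont] by auto
    define W' where "W' = W(Suc k := W\<^sub>1)"
    have W': "W' j = W j" if "j \<le> k" for j using that by (simp add: W'_def)
    have W'_Suc: "W' (Suc k) = W\<^sub>1" by (simp add: W'_def)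
    have "element (Suc k) W'"
      unfolding element_def
    proof (intro conjI allI ballI impI)
      show "W' j x \<in> carrier_mat (n j) (n j)" if "j \<le> Suc k" "x \<in> topspace (X j)" for j x
        using that W\<^sub>1(1) is_chain_mat_carrier elementD(1)[OF W] W' W'_Suc by (cases "j = Suc k") auto
      show "continuous_map (X j) euclidean (\<lambda>x. W' j x $$ (r, s))"
        if "j \<le> Suc k" "r < n j" "s < n j" for j r s
        using that W\<^sub>1(3) elementD(2)[OF W] W' W'_Suc by (cases "j = Suc k") auto
      show "W' (Suc i) y = diag_block_mat (map (\<lambda>z. W' (fst z) (snd z)) (blocks i y))"
        if i: "i < Suc k" and y: "y \<in> X0 (Suc i)" for i y
      proof -
        have iK: "i < K" using i Suc.prems by simp
        have "W' (Suc i) y = diag_block_mat (map (\<lambda>z. W (fst z) (snd z)) (blocks i y))"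
          using i y W\<^sub>1(2) elementD(3)[OF W _ y] W' W'_Suc W\<^sub>0_def by (cases "i = k") auto
        also have "map (\<lambda>z. W (fst z) (snd z)) (blocks i y) = map (\<lambda>z. W' (fst z) (snd z)) (blocks i y)"
        proof (intro map_cong refl)
          fix z assume "z \<in> set (blocks i y)"
          from blocks(1)[OF iK y this] i have "fst z \<le> k" by simp
          then show "W (fst z) (snd z) = W' (fst z) (snd z)" by (simp add: W')
        qed
        finally show ?thesis .
      qed
    qed
    moreover have "is_chain_mat (n j) (W' j x) \<and> block_dominated \<epsilon> (n j) (a j x) (b j x) (W' j x)"
      if "j \<le> Suc k" "x \<in> topspace (X j)" for j x
      using that W\<^sub>1(1) W_dom W' W'_Suc by (cases "j = Suc k") auto
    ultimately show ?case by blast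
  }
qed

lemma positive_elem_diag:
  assumes "positive_elem (rsh_alg X X0 n \<eta> K) a" "j \<le> K" "x \<in> topspace (X j)" "r < n j"
  shows "\<exists>t\<ge>0. a j x $$ (r, r) = of_real t"
proof -
  obtain c where c: "c \<in> A K" and a: "a = adj (rsh_alg X X0 n \<eta> K) c \<otimes>\<^bsub>rsh_alg X X0 n \<eta> K\<^esub> c"
    using assms(1) unfolding positive_elem_def by auto
  have "a j x = mat_adjoint (c j x) * c j x"
    unfolding a using assms(2,3) by (simp add: rsh_alg_def matrix_alg_def Let_def)
  moreover have "c j x \<in> carrier_mat (n j) (n j)"
    using elementD(1)[OF carrier_imp_element[OF c order_refl] assms(2,3)] .
  ultimately show ?thesis
    using mat_adjoint_mult_diag[of "c j x" "n j" r] assms(4)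
    by (auto intro!: exI[of _ "\<Sum>k<n j. (cmod (c j x $$ (k, r)))\<^sup>2"] sum_nonneg)
qed

text \<open>Only values on the spaces matter; off them an extensional element is
  \<open>undefined\<close>, and formulas for it may disagree.\<close>

lemma element_cong:
  assumes "element k F" "k \<le> K" "\<And>j x. j \<le> k \<Longrightarrow> x \<in> topspace (X j) \<Longrightarrow> F j x = G j x"
  shows "element k G"
  unfolding element_def
proof (intro conjI allI ballI impI)
  show "G j x \<in> carrier_mat (n j) (n j)" if "j \<le> k" "x \<in> topspace (X j)" for j x
    using elementD(1)[OF assms(1) that] assms(3)[OF that] by simp
  show "continuous_map (X j) euclidean (\<lambda>x. G j x $$ (r, s))" if "j \<le> k" "r < n j" "s < n j" for j r s
    using elementD(2)[OF assms(1) that] by (rule continuous_map_eq) (simp add: assms(3)[OF that(1)])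
  show "G (Suc i) y = diag_block_mat (map (\<lambda>z. G (fst z) (snd z)) (blocks i y))"
    if i: "i < k" and y: "y \<in> X0 (Suc i)" for i y
  proof -
    have iK: "i < K" and "Suc i \<le> k" and "y \<in> topspace (X (Suc i))"
      using i y assms(2) X0_subset[of "Suc i"] by auto
    then have "G (Suc i) y = F (Suc i) y" using assms(3) by simp
    also have "\<dots> = diag_block_mat (map (\<lambda>z. F (fst z) (snd z)) (blocks i y))"
      by (rule elementD(3)[OF assms(1) i y])
    also have "map (\<lambda>z. F (fst z) (snd z)) (blocks i y) = map (\<lambda>z. G (fst z) (snd z)) (blocks i y)"
    proof (intro map_cong refl)
      fix z assume "z \<in> set (blocks i y)"
      from blocks(1)[OF iK y this] i show "F (fst z) (snd z) = G (fst z) (snd z)"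
        by (intro assms(3)) auto
    qed
    finally show ?thesis .
  qed
qed

text \<open>The pointwise bound also makes the suprema bounded; the inserted 0 then gives the
  estimate from below.\<close>

lemma nrm_rsh_alg_le:
  assumes "0 \<le> c"
    and "\<And>j x. j \<le> K \<Longrightarrow> x \<in> topspace (X j) \<Longrightarrow> op_norm (f j x) \<le> c"
  shows "\<bar>nrm (rsh_alg X X0 n \<eta> K) f\<bar> \<le> c"
proof -
  let ?N = "\<lambda>j. Sup (insert 0 ((\<lambda>x. op_norm (f j x)) ` topspace (X j)))"
  have bound: "0 \<le> ?N j" "?N j \<le> c" if "j \<le> K" for j
  proof -
    have "bdd_above (insert 0 ((\<lambda>x. op_norm (f j x)) ` topspace (X j)))"
      using assms that by (intro bdd_aboveI[of _ c]) auto
    then show "0 \<le> ?N j" by (intro cSup_upper) auto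
    show "?N j \<le> c" using assms that by (intro cSup_least) auto
  qed
  have "nrm (rsh_alg X X0 n \<eta> K) f = Max (?N ` {..K})"
    by (simp add: rsh_alg_def matrix_alg_def Let_def)
  moreover have "Max (?N ` {..K}) \<in> ?N ` {..K}" by (intro Max_in) auto
  then obtain j where "j \<le> K" "Max (?N ` {..K}) = ?N j" by blast
  ultimately show ?thesis using bound[of j] by linarith
qed

text \<open>With \<open>P = R T^-1 H V\<close> and \<open>Q = V R\<close>, the product
  \<open>P b Q\<close> equals \<open>R R\<close>, the part of \<open>a\<close> exceeding
  \<open>\<epsilon>\<close>, which is within \<open>\<epsilon>\<close> of \<open>a\<close>.\<close>

lemma cuntz_below_approx:
  assumes ab: "a \<in> A K" "b \<in> A K"
    and diag: "\<And>j x. j \<le> K \<Longrightarrow> x \<in> topspace (X j) \<Longrightarrow> diagonal_mat (a j x)"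
      "\<And>j x. j \<le> K \<Longrightarrow> x \<in> topspace (X j) \<Longrightarrow> diagonal_mat (b j x)"
    and pos: "\<And>j x r. j \<le> K \<Longrightarrow> x \<in> topspace (X j) \<Longrightarrow> r < n j \<Longrightarrow> \<exists>t\<ge>0. a j x $$ (r, r) = of_real t"
      "\<And>j x r. j \<le> K \<Longrightarrow> x \<in> topspace (X j) \<Longrightarrow> r < n j \<Longrightarrow> \<exists>t\<ge>0. b j x $$ (r, r) = of_real t"
    and rank: "\<And>i x. i \<le> K \<Longrightarrow> x \<in> topspace (X i) - X0 i \<Longrightarrow>
      card {r. r < n i \<and> a i x $$ (r, r) \<noteq> 0} \<le> card {q. q < n i \<and> b i x $$ (q, q) \<noteq> 0}"
    and \<epsilon>: "0 < \<epsilon>"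
  shows "\<exists>x\<in>A K. \<exists>y\<in>A K. \<bar>nrm (rsh_alg X X0 n \<eta> K) (sa_diff (rsh_alg X X0 n \<eta> K)
    (x \<otimes>\<^bsub>rsh_alg X X0 n \<eta> K\<^esub> b \<otimes>\<^bsub>rsh_alg X X0 n \<eta> K\<^esub> y) a)\<bar> \<le> \<epsilon>"
proof -
  note ela = carrier_imp_element[OF ab(1) order_refl] and elb = carrier_imp_element[OF ab(2) order_refl]
  obtain W where W: "element K W"
    and W_dom: "\<And>j x. j \<le> K \<Longrightarrow> x \<in> topspace (X j) \<Longrightarrow>
      is_chain_mat (n j) (W j x) \<and> block_dominated \<epsilon> (n j) (a j x) (b j x) (W j x)"
    using element_chain_mat[OF ela elb \<epsilon> rank order_refl] by blast
  define H where "H j x = map_mat (cutoff \<epsilon>) (a j x)" for j x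
  define R where "R j x = map_mat (sqrt_excess \<epsilon>) (a j x)" for j x
  define V where "V j x = map_mat cauchy_entry (W j x)" for j x
  define T where "T j x = compression \<epsilon> (a j x) (b j x) (W j x)" for j x
  define P where "P j x = R j x * (inv_mat (T j x) * (H j x * V j x))" for j x
  define Q where "Q j x = V j x * R j x" for j x
  \<comment> \<open>The single-point results, applied with the weights of \<open>W j x\<close> and
    the real diagonal entries of \<open>a\<close> and \<open>b\<close>.\<close>
  have pointwise: "Determinant.det (T j x) \<noteq> 0 \<and> P j x * b j x * Q j x = R j x * R j x
      \<and> (\<exists>\<alpha>. \<forall>r<n j. 0 \<le> \<alpha> r \<and> a j x $$ (r, r) = of_real (\<alpha> r)
        \<and> (\<forall>s<n j. (R j x * R j x) $$ (r, s) = (if r = s then of_real (max (\<alpha> r - \<epsilon>) 0) else 0)))"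
    if j: "j \<le> K" and x: "x \<in> topspace (X j)" for j x
  proof -
    define \<alpha> where "\<alpha> r = Re (a j x $$ (r, r))" for r
    define \<beta> where "\<beta> r = Re (b j x $$ (r, r))" for r
    have \<alpha>: "a j x $$ (r, r) = of_real (\<alpha> r)" "0 \<le> \<alpha> r"
      and \<beta>: "b j x $$ (r, r) = of_real (\<beta> r)" "0 \<le> \<beta> r" if "r < n j" for r
      using pos(1)[OF j x that] pos(2)[OF j x that] by (auto simp: \<alpha>_def \<beta>_def)
    obtain w where w: "\<forall>k. 0 \<le> w k \<and> w k < 1" and Ww: "W j x = chain_mat w (n j)"
      using W_dom[OF j x] unfolding is_chain_mat_def by (elim conjE exE)
    have w': "0 \<le> w k" "w k < 1" for k using w by auto
    have dom: "block_dominated \<epsilon> (n j) (a j x) (b j x) (W j x)" using W_dom[OF j x] ..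
    note facts = \<epsilon> elementD(1)[OF ela j x] diag(1)[OF j x] \<alpha>(1) elementD(1)[OF elb j x] diag(2)[OF j x] \<beta>(1)
      \<alpha>(2) \<beta>(2) w' Ww dom
    have "Determinant.det (T j x) \<noteq> 0"
      unfolding T_def by (rule det_compression) (fact facts | erule facts)+
    moreover have "P j x * b j x * Q j x = R j x * R j x"
      unfolding P_def Q_def T_def H_def V_def R_def by (rule compression_sandwich) (fact facts | erule facts)+
    moreover have "(R j x * R j x) $$ (r, s) = (if r = s then of_real (max (\<alpha> r - \<epsilon>) 0) else 0)"
      if "r < n j" "s < n j" for r s
      unfolding R_def by (rule sqrt_excess_square) (fact facts | erule facts | fact that)+
    ultimately show ?thesis using \<alpha> by (intro conjI exI[of _ \<alpha>]) auto
  qed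
  have el: "element K H" "element K R" "element K V"
    unfolding H_def R_def V_def using \<epsilon>
    by (auto intro!: element_map_mat ela W continuous_on_cutoff continuous_on_sqrt_excess
        continuous_on_cauchy_entry sqrt_excess_0)
  \<comment> \<open>The unit here has size \<open>n j\<close>, whereas \<open>compression\<close>
    takes its size from \<open>a j x\<close>; the two agree on the spaces.\<close>
  have "element K (\<lambda>j x. H j x * V j x * b j x * (V j x * H j x)
      + (1\<^sub>m (n j) + map_mat (\<lambda>z. - cutoff \<epsilon> z) (a j x)))"
    using \<epsilon> by (intro element_add element_mult element_one element_map_mat el ela elb order_refl)
      (auto intro!: continuous_on_minus continuous_on_cutoff)
  then have elT: "element K T"
  proof (rule element_cong[OF _ order_refl])
    fix j x assume "j \<le> K" "x \<in> topspace (X j)"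
    then have "dim_row (a j x) = n j" using elementD(1)[OF ela] by auto
    then show "H j x * V j x * b j x * (V j x * H j x)
      + (1\<^sub>m (n j) + map_mat (\<lambda>z. - cutoff \<epsilon> z) (a j x)) = T j x"
      by (simp add: T_def compression_def H_def V_def)
  qed
  have elP: "element K P"
    unfolding P_def using pointwise
    by (intro element_mult element_inv_mat el elT order_refl) auto
  have elQ: "element K Q"
    unfolding Q_def by (intro element_mult el order_refl)
  let ?B = "rsh_alg X X0 n \<eta> K"
  let ?D = "sa_diff ?B (family K P \<otimes>\<^bsub>?B\<^esub> b \<otimes>\<^bsub>?B\<^esub> family K Q) a"
  have "op_norm (?D j x) \<le> \<epsilon>" if j: "j \<le> K" and x: "x \<in> topspace (X j)" for j x
  proof -
    obtain \<alpha> where \<alpha>: "\<And>r. r < n j \<Longrightarrow> 0 \<le> \<alpha> r" "\<And>r. r < n j \<Longrightarrow> a j x $$ (r, r) = of_real (\<alpha> r)"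
      "\<And>r s. r < n j \<Longrightarrow> s < n j \<Longrightarrow> (R j x * R j x) $$ (r, s) = (if r = s then of_real (max (\<alpha> r - \<epsilon>) 0) else 0)"
      using pointwise[OF j x] by auto
    have D: "?D j x = R j x * R j x + (-1) \<cdot>\<^sub>m a j x"
      using j x pointwise[OF j x] by (simp add: sa_diff_def rsh_alg_def matrix_alg_def Let_def)
    have car: "R j x \<in> carrier_mat (n j) (n j)" "a j x \<in> carrier_mat (n j) (n j)"
      using elementD(1)[OF el(2) j x] elementD(1)[OF ela j x] by auto
    show ?thesis
      unfolding D
    proof (rule op_norm_diagonal_le)
      show "R j x * R j x + (-1) \<cdot>\<^sub>m a j x \<in> carrier_mat (n j) (n j)" using car by auto
      show "0 \<le> \<epsilon>" using \<epsilon> by simp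
      fix r assume r: "r < n j"
      \<comment> \<open>For \<open>\<alpha> \<ge> 0\<close>, the difference of
        \<open>max (\<alpha> - \<epsilon>) 0\<close> and \<open>\<alpha>\<close> lies between
        \<open>- \<epsilon>\<close> and 0.\<close>
      show "cmod (of_real (max (\<alpha> r - \<epsilon>) 0 - \<alpha> r)) \<le> \<epsilon>"
        unfolding norm_of_real using \<alpha>(1)[OF r] \<epsilon> by linarith
      fix s assume s: "s < n j"
      have "a j x $$ (r, s) = (if r = s then of_real (\<alpha> r) else 0)"
        using diag(1)[OF j x] car \<alpha>(2) r s by (auto simp: diagonal_mat_def)
      then show "(R j x * R j x + (-1) \<cdot>\<^sub>m a j x) $$ (r, s)
          = (if r = s then of_real (max (\<alpha> r - \<epsilon>) 0 - \<alpha> r) else 0)"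
        using car r s \<alpha>(3)[OF r s] by (simp del: index_mult_mat(1))
    qed
  qed
  then have "\<bar>nrm ?B ?D\<bar> \<le> \<epsilon>" using \<epsilon> by (intro nrm_rsh_alg_le) auto
  then show ?thesis
    using element_imp_carrier[OF elP order_refl] element_imp_carrier[OF elQ order_refl] by blast
qed

end

theorem theorem7p8:
  fixes K :: nat
    and X :: "nat \<Rightarrow> 'a topology"
    and X0 :: "nat \<Rightarrow> 'a set"
    and n :: "nat \<Rightarrow> nat"
    and \<eta> :: "nat \<Rightarrow> (nat \<Rightarrow> 'a \<Rightarrow> complex mat) \<Rightarrow> 'a \<Rightarrow> complex mat"
    and a b :: "nat \<Rightarrow> 'a \<Rightarrow> complex mat"
  assumes "rsh_decomposition K X X0 n \<eta>"
    and "separable_alg (rsh_alg X X0 n \<eta> K)"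
    and "a \<in> carrier (rsh_alg X X0 n \<eta> K)" and "positive_elem (rsh_alg X X0 n \<eta> K) a"
    and "b \<in> carrier (rsh_alg X X0 n \<eta> K)" and "positive_elem (rsh_alg X X0 n \<eta> K) b"
    and "\<forall>i<K. n i < n (Suc i)"
    and "\<forall>i\<le>K. \<forall>x\<in>topspace (X i). diagonal_mat (a i x) \<and> diagonal_mat (b i x)"
    and "\<forall>i<K. diagonal_type X i (rsh_alg X X0 n \<eta> i)
           (subtopology (X (Suc i)) (X0 (Suc i))) (\<eta> i)"
    and "\<forall>i\<le>K. \<forall>x\<in>topspace (X i) - X0 i.
           real (vec_space.rank (n i) (a i x)) < 1/4 * real (vec_space.rank (n i) (b i x)) \<and>
           1 / real (n 0) < real (vec_space.rank (n i) (b i x)) / (4 * real (n i))"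
  shows "cuntz_below (rsh_alg X X0 n \<eta> K) a b"
proof -
  interpret diagonal_rsh K X X0 n \<eta>
    using assms(1,9) by unfold_locales
  let ?B = "rsh_alg X X0 n \<eta> K"
  have ab: "a \<in> A K" "b \<in> A K" using assms(3,5) by simp_all
  \<comment> \<open>For diagonal matrices the rank counts nonzero diagonal entries, so the rank
    hypothesis becomes a comparison of index sets.\<close>
  have rank: "card {r. r < n i \<and> a i x $$ (r, r) \<noteq> 0} \<le> card {q. q < n i \<and> b i x $$ (q, q) \<noteq> 0}"
    if i: "i \<le> K" and x: "x \<in> topspace (X i) - X0 i" for i x
  proof -
    have x': "x \<in> topspace (X i)" using x by blast
    have "a i x \<in> carrier_mat (n i) (n i)" "b i x \<in> carrier_mat (n i) (n i)"
      using elementD(1)[OF carrier_imp_element[OF ab(1) order_refl] i x']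
        elementD(1)[OF carrier_imp_element[OF ab(2) order_refl] i x'] .
    moreover have "real (vec_space.rank (n i) (a i x)) < 1/4 * real (vec_space.rank (n i) (b i x))"
      using assms(10) i x by blast
    ultimately show ?thesis using assms(8) i x' by (simp add: rank_diagonal)
  qed
  \<comment> \<open>Taking \<open>\<epsilon> = 1 / (m + 1)\<close> produces the sequences in the
    definition of Cuntz subequivalence.\<close>
  have "\<exists>x\<in>A K. \<exists>y\<in>A K. \<bar>nrm ?B (sa_diff ?B (x \<otimes>\<^bsub>?B\<^esub> b \<otimes>\<^bsub>?B\<^esub> y) a)\<bar> \<le> inverse (real (Suc m))" for m
    by (rule cuntz_below_approx[OF ab])
      (use assms(8) positive_elem_diag[OF assms(4)] positive_elem_diag[OF assms(6)] rank in auto)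
  then obtain x y where xy: "\<And>m. x m \<in> A K" "\<And>m. y m \<in> A K"
    "\<And>m. \<bar>nrm ?B (sa_diff ?B (x m \<otimes>\<^bsub>?B\<^esub> b \<otimes>\<^bsub>?B\<^esub> y m) a)\<bar> \<le> inverse (real (Suc m))"
    by metis
  have "(\<lambda>m. nrm ?B (sa_diff ?B (x m \<otimes>\<^bsub>?B\<^esub> b \<otimes>\<^bsub>?B\<^esub> y m) a)) \<longlonglongrightarrow> 0"
    by (rule tendsto_rabs_zero_cancel,
        rule tendsto_sandwich[OF _ _ tendsto_const LIMSEQ_inverse_real_of_nat])
      (use xy(3) in auto)
  then show ?thesis
    unfolding cuntz_below_def using xy(1,2) by (intro exI[of _ x] exI[of _ y]) simp
qed

end
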